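(* Let $L$ be a language for coloured quadripartite graphs, and let $\mathcal{F}$ be a family of pairwise non-embeddable monic $L$-graphs. Then there is a (unique up to isomorphism) countable homogeneous $4$-generic $L$-graph $G$ with $\mathrm{Age}(G)=\mathrm{Forb}(\mathcal{F})$ if and only if $\mathcal{F}$ satisfies: (i) whenever $\mathcal{A}\subseteq\mathcal{F}$ is a $C_{ij}^{kl}$-omission set, there is a corresponding $C_{kl}^{ij}$-omission set $\mathcal{B}\subseteq\mathcal{F}$; (ii) whenever $\mathcal{A}\subseteq\mathcal{F}$ is a $C_{ij}$-cover set (for distinct $i,j$), there is a $C_{ij}^{kl}$-omission set in $\mathcal{F}$ based on $\mathcal{A}$, where $\{k,l\}=\{0,1,2,3\}\setminus\{i,j\}$ (so in particular $\mathcal{A}$ must contain some $ijk$-triangles and some $ijl$-triangles).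
   Context: A language $L$ for coloured $m$-partite graphs (here $m=4$) specifies, for each pair of distinct $i,j$, a finite nonempty set of colours $C_{ij}=C_{ji}$. An $L$-graph has vertex set partitioned into parts $V_0,\dots,V_{m-1}$ (no edges inside parts) with a colour $F(x,y)=F(y,x)\in C_{ij}$ for $x\in V_i,y\in V_j$, $i\ne j$. Substructures are induced subgraphs; embeddings are injective, part- and colour-preserving. $G$ is homogeneous if every isomorphism between finite induced subgraphs extends to an automorphism. $G$ is $m$-generic if every part is countably infinite and for all distinct $i,j$, finite $U\subseteq V_i$ and $f:U\to C_{ij}$ there is $x\in V_j$ with $F(x,u)=f(u)$ for all $u\in U$. $\mathrm{Age}(G)$ is the class of finite $L$-graphs embeddable in $G$; $\mathrm{Forb}(\mathcal{F})$ is the class of finite $L$-graphs into which no member of $\mathcal{F}$ embeds. A monic is a finite $L$-graph with at most one vertex in each part; an $ijk$-triangle has exactly one vertex in each of $V_i,V_j,V_k$ and none elsewhere. For a monic $A$ with vertices in $V_i,V_j$, $F_A(E_{ij})$ is the colour of the edge (its $E_{ij}$-edge) between them. A $C_{ij}$-cover set is a set of monics such that for each $c\in C_{ij}$ some member has $E_{ij}$-edge coloured $c$. For distinct $i,j,k,l$, a $C_{ij}^{kl}$-omission set is a $C_{ij}$-cover set of $ijk$-triangles and $ijl$-triangles with colours $c_{ik},c_{il},c_{jk},c_{jl}$ such that every $ijk$-triangle in it has $E_{ik},E_{jk}$-edges coloured $c_{ik},c_{jk}$ and every $ijl$-triangle in it has $E_{il},E_{jl}$-edges coloured $c_{il},c_{jl}$;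 its code is $(i,j,k,l;c_{ik},c_{il},c_{jk},c_{jl})$. A corresponding $C_{kl}^{ij}$-omission set is one with the same code (a $C_{kl}$-cover set of $ikl$-triangles with $E_{ik},E_{il}$ coloured $c_{ik},c_{il}$ and $jkl$-triangles with $E_{jk},E_{jl}$ coloured $c_{jk},c_{jl}$). A $C_{ij}^{kl}$-omission set with code $(i,j,k,l;c_{ik},c_{il},c_{jk},c_{jl})$ is based on a $C_{ij}$-cover set $\mathcal{A}$ if there are (not necessarily distinct) $A,A'\in\mathcal{A}$ with $A$ having vertices in $V_i,V_j,V_k$ and $F_A(E_{ik})=c_{ik}$, $F_A(E_{jk})=c_{jk}$, and $A'$ having vertices in $V_i,V_j,V_l$ and $F_{A'}(E_{il})=c_{il}$, $F_{A'}(E_{jl})=c_{jl}$.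
   Formalization: A third condition is added beside (i) and (ii): every member of F has at least three vertices. Without it the "if" direction fails, e.g. when F is a single edge of one colour between two parts having at least two colours. *)

theory Defs
  imports Main "HOL-Library.Countable_Set"
begin

text \<open>
  A language for coloured \<open>m\<close>-partite graphs: parts are indexed by \<open>0, \<dots>, m - 1\<close>, and
  \<open>C i j\<close> is the set of colours for edges between parts \<open>i\<close> and \<open>j\<close>.  Values of \<open>C\<close> at
  equal or out-of-range indices are irrelevant.
\<close>

definition language :: "nat \<Rightarrow> (nat \<Rightarrow> nat \<Rightarrow> 'c set) \<Rightarrow> bool" where
  "language m C \<longleftrightarrow>
     (\<forall>i<m. \<forall>j<m. i \<noteq> j \<longrightarrow> finite (C i j) \<and> C i j \<noteq> {} \<and> C i j = C j i)"

text \<open>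
  The partition is given by the part index of each vertex; \<open>part\<close> and \<open>col\<close> are
  meaningful only on \<open>verts\<close>, and \<open>col\<close> only between vertices of different parts.
\<close>

record ('v, 'c) lgraph =
  verts :: "'v set"
  part :: "'v \<Rightarrow> nat"
  col :: "'v \<Rightarrow> 'v \<Rightarrow> 'c"

definition is_lgraph :: "nat \<Rightarrow> (nat \<Rightarrow> nat \<Rightarrow> 'c set) \<Rightarrow> ('v, 'c) lgraph \<Rightarrow> bool" where
  "is_lgraph m C G \<longleftrightarrow>
     (\<forall>x\<in>verts G. part G x < m) \<and>
     (\<forall>x\<in>verts G. \<forall>y\<in>verts G. part G x \<noteq> part G y \<longrightarrow>
        col G x y \<in> C (part G x) (part G y) \<and> col G x y = col G y x)"

definition part_set :: "('v, 'c) lgraph \<Rightarrow> nat \<Rightarrow> 'v set" where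
  "part_set G i = {x \<in> verts G. part G x = i}"

definition embedding :: "('v \<Rightarrow> 'w) \<Rightarrow> ('v, 'c) lgraph \<Rightarrow> ('w, 'c) lgraph \<Rightarrow> bool" where
  "embedding f A B \<longleftrightarrow>
     inj_on f (verts A) \<and> f ` verts A \<subseteq> verts B \<and>
     (\<forall>x\<in>verts A. part B (f x) = part A x) \<and>
     (\<forall>x\<in>verts A. \<forall>y\<in>verts A. part A x \<noteq> part A y \<longrightarrow> col B (f x) (f y) = col A x y)"

definition embeds :: "('v, 'c) lgraph \<Rightarrow> ('w, 'c) lgraph \<Rightarrow> bool" where
  "embeds A B \<longleftrightarrow> (\<exists>f. embedding f A B)"

definition isomorphism :: "('v \<Rightarrow> 'w) \<Rightarrow> ('v, 'c) lgraph \<Rightarrow> ('w, 'c) lgraph \<Rightarrow> bool" where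
  "isomorphism f A B \<longleftrightarrow> embedding f A B \<and> f ` verts A = verts B"

definition isomorphic :: "('v, 'c) lgraph \<Rightarrow> ('w, 'c) lgraph \<Rightarrow> bool" where
  "isomorphic A B \<longleftrightarrow> (\<exists>f. isomorphism f A B)"

definition induced :: "('v, 'c) lgraph \<Rightarrow> 'v set \<Rightarrow> ('v, 'c) lgraph" where
  "induced G S = G\<lparr>verts := S\<rparr>"

definition homogeneous :: "('v, 'c) lgraph \<Rightarrow> bool" where
  "homogeneous G \<longleftrightarrow>
     (\<forall>S T f. finite S \<and> S \<subseteq> verts G \<and> finite T \<and> T \<subseteq> verts G \<and>
        isomorphism f (induced G S) (induced G T) \<longrightarrow>
        (\<exists>g. isomorphism g G G \<and> (\<forall>x\<in>S. g x = f x)))"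

definition generic :: "nat \<Rightarrow> (nat \<Rightarrow> nat \<Rightarrow> 'c set) \<Rightarrow> ('v, 'c) lgraph \<Rightarrow> bool" where
  "generic m C G \<longleftrightarrow>
     (\<forall>i<m. countable (part_set G i) \<and> infinite (part_set G i)) \<and>
     (\<forall>i<m. \<forall>j<m. i \<noteq> j \<longrightarrow>
        (\<forall>U f. finite U \<and> U \<subseteq> part_set G i \<and> (\<forall>u\<in>U. f u \<in> C i j) \<longrightarrow>
           (\<exists>x\<in>part_set G j. \<forall>u\<in>U. col G x u = f u)))"

text \<open>
  Classes of finite graphs are represented by sets of graphs with vertices in \<^typ>\<open>nat\<close>;
  every finite graph has an isomorphic copy of this form.
\<close>

definition age :: "nat \<Rightarrow> (nat \<Rightarrow> nat \<Rightarrow> 'c set) \<Rightarrow> ('v, 'c) lgraph \<Rightarrow> (nat, 'c) lgraph set" where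
  "age m C G = {A. is_lgraph m C A \<and> finite (verts A) \<and> embeds A G}"

definition forb ::
  "nat \<Rightarrow> (nat \<Rightarrow> nat \<Rightarrow> 'c set) \<Rightarrow> (nat, 'c) lgraph set \<Rightarrow> (nat, 'c) lgraph set" where
  "forb m C \<F> = {A. is_lgraph m C A \<and> finite (verts A) \<and> (\<forall>B\<in>\<F>. \<not> embeds B A)}"

definition countable_homogeneous_generic_with_age ::
  "nat \<Rightarrow> (nat \<Rightarrow> nat \<Rightarrow> 'c set) \<Rightarrow> (nat, 'c) lgraph set \<Rightarrow> ('v, 'c) lgraph \<Rightarrow> bool" where
  "countable_homogeneous_generic_with_age m C \<K> G \<longleftrightarrow>
     is_lgraph m C G \<and> countable (verts G) \<and> homogeneous G \<and> generic m C G \<and> age m C G = \<K>"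

definition monic :: "nat \<Rightarrow> (nat \<Rightarrow> nat \<Rightarrow> 'c set) \<Rightarrow> ('v, 'c) lgraph \<Rightarrow> bool" where
  "monic m C A \<longleftrightarrow>
     is_lgraph m C A \<and> finite (verts A) \<and> (\<forall>i<m. card (part_set A i) \<le> 1)"

definition pairwise_non_embeddable :: "('v, 'c) lgraph set \<Rightarrow> bool" where
  "pairwise_non_embeddable \<F> \<longleftrightarrow> (\<forall>A\<in>\<F>. \<forall>B\<in>\<F>. A \<noteq> B \<longrightarrow> \<not> embeds A B)"

definition triangle :: "nat \<Rightarrow> nat \<Rightarrow> nat \<Rightarrow> ('v, 'c) lgraph \<Rightarrow> bool" where
  "triangle i j k A \<longleftrightarrow>
     (\<forall>p\<in>{i, j, k}. card (part_set A p) = 1) \<and> (\<forall>p. p \<notin> {i, j, k} \<longrightarrow> part_set A p = {})"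

text \<open>
  For monic \<open>A\<close>, the relation \<open>edge_coloured A i j c\<close> says that \<open>A\<close> has vertices in parts
  \<open>i\<close> and \<open>j\<close> and that its (unique) edge between them has colour \<open>c\<close>.
\<close>

definition edge_coloured :: "('v, 'c) lgraph \<Rightarrow> nat \<Rightarrow> nat \<Rightarrow> 'c \<Rightarrow> bool" where
  "edge_coloured A i j c \<longleftrightarrow> (\<exists>x\<in>part_set A i. \<exists>y\<in>part_set A j. col A x y = c)"

definition cover_set ::
  "nat \<Rightarrow> (nat \<Rightarrow> nat \<Rightarrow> 'c set) \<Rightarrow> nat \<Rightarrow> nat \<Rightarrow> ('v, 'c) lgraph set \<Rightarrow> bool" where
  "cover_set m C i j \<A> \<longleftrightarrow>
     (\<forall>A\<in>\<A>. monic m C A) \<and> (\<forall>c\<in>C i j. \<exists>A\<in>\<A>. edge_coloured A i j c)"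

text \<open>
  \<open>omission_set m C i j k l cik cil cjk cjl \<A>\<close>: the set \<open>\<A>\<close> is a
  \<open>C\<^sub>i\<^sub>j\<^sup>k\<^sup>l\<close>-omission set with code \<open>(i, j, k, l; cik, cil, cjk, cjl)\<close>.
\<close>

definition omission_set ::
  "nat \<Rightarrow> (nat \<Rightarrow> nat \<Rightarrow> 'c set) \<Rightarrow> nat \<Rightarrow> nat \<Rightarrow> nat \<Rightarrow> nat \<Rightarrow>
   'c \<Rightarrow> 'c \<Rightarrow> 'c \<Rightarrow> 'c \<Rightarrow> ('v, 'c) lgraph set \<Rightarrow> bool" where
  "omission_set m C i j k l cik cil cjk cjl \<A> \<longleftrightarrow>
     cik \<in> C i k \<and> cil \<in> C i l \<and> cjk \<in> C j k \<and> cjl \<in> C j l \<and>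
     cover_set m C i j \<A> \<and>
     (\<forall>A\<in>\<A>. (triangle i j k A \<and> edge_coloured A i k cik \<and> edge_coloured A j k cjk) \<or>
              (triangle i j l A \<and> edge_coloured A i l cil \<and> edge_coloured A j l cjl))"

text \<open>
  The \<open>C\<^sub>k\<^sub>l\<^sup>i\<^sup>j\<close>-omission sets with the same code \<open>(i, j, k, l; cik, cil, cjk, cjl)\<close>.
  Exchanging the index pairs exchanges \<open>cil\<close> and \<open>cjk\<close> in the argument list.
\<close>

definition corresponding_omission_set ::
  "nat \<Rightarrow> (nat \<Rightarrow> nat \<Rightarrow> 'c set) \<Rightarrow> nat \<Rightarrow> nat \<Rightarrow> nat \<Rightarrow> nat \<Rightarrow>
   'c \<Rightarrow> 'c \<Rightarrow> 'c \<Rightarrow> 'c \<Rightarrow> ('v, 'c) lgraph set \<Rightarrow> bool" where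
  "corresponding_omission_set m C i j k l cik cil cjk cjl \<B> \<longleftrightarrow>
     omission_set m C k l i j cik cjk cil cjl \<B>"

definition based_on ::
  "nat \<Rightarrow> nat \<Rightarrow> nat \<Rightarrow> nat \<Rightarrow> 'c \<Rightarrow> 'c \<Rightarrow> 'c \<Rightarrow> 'c \<Rightarrow> ('v, 'c) lgraph set \<Rightarrow> bool" where
  "based_on i j k l cik cil cjk cjl \<A> \<longleftrightarrow>
     (\<exists>A\<in>\<A>. \<exists>A'\<in>\<A>.
        part_set A i \<noteq> {} \<and> part_set A j \<noteq> {} \<and> part_set A k \<noteq> {} \<and>
        edge_coloured A i k cik \<and> edge_coloured A j k cjk \<and>
        part_set A' i \<noteq> {} \<and> part_set A' j \<noteq> {} \<and> part_set A' l \<noteq> {} \<and>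
        edge_coloured A' i l cil \<and> edge_coloured A' j l cjl)"

definition distinct_indices :: "nat \<Rightarrow> nat \<Rightarrow> nat \<Rightarrow> nat \<Rightarrow> bool" where
  "distinct_indices i j k l \<longleftrightarrow> distinct [i, j, k, l] \<and> {i, j, k, l} = {0, 1, 2, 3}"

definition omission_condition ::
  "(nat \<Rightarrow> nat \<Rightarrow> 'c set) \<Rightarrow> ('v, 'c) lgraph set \<Rightarrow> bool" where
  "omission_condition C \<F> \<longleftrightarrow>
     (\<forall>i j k l cik cil cjk cjl. \<forall>\<A>\<subseteq>\<F>.
        distinct_indices i j k l \<and> omission_set 4 C i j k l cik cil cjk cjl \<A> \<longrightarrow>
        (\<exists>\<B>\<subseteq>\<F>. corresponding_omission_set 4 C i j k l cik cil cjk cjl \<B>))"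

definition cover_condition ::
  "(nat \<Rightarrow> nat \<Rightarrow> 'c set) \<Rightarrow> ('v, 'c) lgraph set \<Rightarrow> bool" where
  "cover_condition C \<F> \<longleftrightarrow>
     (\<forall>i j k l. \<forall>\<A>\<subseteq>\<F>.
        distinct_indices i j k l \<and> cover_set 4 C i j \<A> \<longrightarrow>
        (\<exists>\<B>\<subseteq>\<F>. \<exists>cik cil cjk cjl.
           omission_set 4 C i j k l cik cil cjk cjl \<B> \<and>
           based_on i j k l cik cil cjk cjl \<A>))"

text \<open>
  The equivalence concerns forbidden monics meeting at least three parts.  Genericity
  puts every graph with at most one vertex, and every edge of every colour, into the age,
  so no generic graph omits a smaller monic; on the other hand the two conditions above
  do not exclude smaller ones.  (Take \<open>C 0 1\<close> with two colours and \<open>\<F>\<close> consisting of a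
  single coloured edge between parts 0 and 1: \<open>\<F>\<close> contains no cover set, so both
  conditions hold vacuously, yet every generic graph embeds that edge.)
\<close>

definition no_small_members :: "('v, 'c) lgraph set \<Rightarrow> bool" where
  "no_small_members \<F> \<longleftrightarrow> (\<forall>A\<in>\<F>. 3 \<le> card (verts A))"

end

theory Submission imports Defs begin

text \<open>
  A graph lies in \<open>Forb(\<F>)\<close> as soon as its monics do, so amalgamation has to be decided only
  for two vertices \<open>x\<close>, \<open>y\<close> in different parts \<open>i\<close>, \<open>j\<close> over a common finite graph: some colour
  in \<open>C i j\<close> must be free for the edge \<open>xy\<close>.  If every colour is blocked, the blocking members
  of \<open>\<F>\<close> form a cover set; the cover condition extracts an omission set based on it, whose
  witnesses are vertices \<open>u\<close>, \<open>v\<close> in the two other parts, and the omission condition then makes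
  \<open>xuv\<close> or \<open>yuv\<close> forbidden whatever the colour of \<open>uv\<close>, a contradiction.  Conversely, a failure of
  the omission condition or of the cover condition yields two one-point extensions of a finite
  graph in the age that cannot be amalgamated: for the cover condition one places, for each
  colour \<open>c\<close>, the vertices outside parts \<open>i\<close>, \<open>j\<close> of a member of the cover set with
  \<open>E\<^sub>i\<^sub>j\<close>-edge \<open>c\<close> below the two new vertices.
\<close>

section \<open>Embeddings and one-point extensions\<close>

lemma induced_simps [simp]:
  "verts (induced G S) = S" "part (induced G S) = part G" "col (induced G S) = col G"
  by (simp_all add: induced_def)

lemma induced_induced [simp]: "induced (induced G S) T = induced G T"
  by (simp add: induced_def)

lemma induced_verts [simp]: "induced G (verts G) = G"
  by (simp add: induced_def)

lemma embedding_cong: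
  assumes "\<And>x. x \<in> verts A \<Longrightarrow> f x = g x"
  shows "embedding f A B \<longleftrightarrow> embedding g A B"
proof -
  have "f ` verts A = g ` verts A" "inj_on f (verts A) \<longleftrightarrow> inj_on g (verts A)"
    using assms by (auto intro!: image_cong inj_on_cong)
  then show ?thesis
    unfolding embedding_def using assms by auto
qed

text \<open>Serves to move a copy of a member of \<F> between graphs that agree on its image, such
  as a graph and a one-point extension of it, or a countable graph and a finite stage of its
  construction.\<close>

lemma embedding_retarget:
  assumes "embedding f A B" "f ` verts A \<subseteq> verts B'"
    and "\<And>x. x \<in> f ` verts A \<Longrightarrow> part B' x = part B x"
    and "\<And>x y. \<lbrakk>x \<in> f ` verts A; y \<in> f ` verts A\<rbrakk> \<Longrightarrow> col B' x y = col B x y"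
  shows "embedding f A B'"
  using assms unfolding embedding_def by simp

lemma embedding_comp:
  assumes "embedding f A B" "embedding g B D"
  shows "embedding (g \<circ> f) A D"
proof -
  have inj: "inj_on (g \<circ> f) (verts A)"
    using assms unfolding embedding_def by (meson comp_inj_on inj_on_subset)
  have mem: "f x \<in> verts B" if "x \<in> verts A" for x
    using assms(1) that unfolding embedding_def by auto
  show ?thesis
    using assms inj mem unfolding embedding_def by (simp add: image_subset_iff)
qed

lemma embedding_induced:
  assumes "embedding f A B" "S \<subseteq> verts A"
  shows "embedding f (induced A S) B"
  using assms unfolding embedding_def by (auto simp: inj_on_subset subset_iff)

lemma embedding_id: "S \<subseteq> verts G \<Longrightarrow> embedding id (induced G S) G"
  by (auto simp: embedding_def)

lemma embedding_inv:
  assumes "isomorphism f A B"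
  shows "isomorphism (inv_into (verts A) f) B A"
proof -
  let ?g = "inv_into (verts A) f"
  have bij: "bij_betw f (verts A) (verts B)"
    using assms by (simp add: isomorphism_def embedding_def bij_betw_def)
  then have bij': "bij_betw ?g (verts B) (verts A)"
    by (rule bij_betw_inv_into)
  have fg: "f (?g y) = y" "?g y \<in> verts A" if "y \<in> verts B" for y
    using that bij bij' by (auto simp: bij_betw_inv_into_right bij_betwE)
  have part: "part A (?g y) = part B y" if "y \<in> verts B" for y
    using assms fg[OF that] unfolding isomorphism_def embedding_def by metis
  have col: "col A (?g y) (?g z) = col B y z"
    if "y \<in> verts B" "z \<in> verts B" "part B y \<noteq> part B z" for y z
    using assms fg[OF that(1)] fg[OF that(2)] part that
    unfolding isomorphism_def embedding_def by metis
  show ?thesis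
    using bij' part col by (auto simp: isomorphism_def embedding_def bij_betw_def)
qed

lemma lgraph_col_commute:
  "\<lbrakk>is_lgraph m C A; x \<in> verts A; y \<in> verts A; part A x \<noteq> part A y\<rbrakk> \<Longrightarrow> col A x y = col A y x"
  and lgraph_col_in:
  "\<lbrakk>is_lgraph m C A; x \<in> verts A; y \<in> verts A; part A x \<noteq> part A y\<rbrakk> \<Longrightarrow>
    col A x y \<in> C (part A x) (part A y)"
  by (simp_all add: is_lgraph_def)

lemma is_lgraph_pullback:
  assumes "is_lgraph m C B" "embedding f A B"
  shows "is_lgraph m C A"
proof -
  have f: "f x \<in> verts B" "part B (f x) = part A x" if "x \<in> verts A" for x
    using assms(2) that by (auto simp: embedding_def)
  have col: "col B (f x) (f y) = col A x y"
    if "x \<in> verts A" "y \<in> verts A" "part A x \<noteq> part A y" for x y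
    using assms(2) that by (auto simp: embedding_def)
  show ?thesis
    unfolding is_lgraph_def
  proof (intro conjI ballI impI)
    fix x assume "x \<in> verts A"
    then show "part A x < m" using f assms(1) unfolding is_lgraph_def by metis
  next
    fix x y assume *: "x \<in> verts A" "y \<in> verts A" "part A x \<noteq> part A y"
    then have "col B (f x) (f y) \<in> C (part A x) (part A y)"
      "col B (f x) (f y) = col B (f y) (f x)"
      using f assms(1) unfolding is_lgraph_def by metis+
    then show "col A x y \<in> C (part A x) (part A y)" "col A x y = col A y x"
      using col[of x y] col[of y x] * by auto
  qed
qed

lemma finite_copy_on_nat:
  assumes "finite (verts A)"
  shows "\<exists>(A' :: (nat, 'c) lgraph) h. isomorphism h (A :: ('v, 'c) lgraph) A'"
proof -
  obtain h :: "'v \<Rightarrow> nat" where h: "inj_on h (verts A)"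
    using finite_imp_inj_to_nat_seg[OF assms] by blast
  let ?k = "inv_into (verts A) h"
  let ?A = "\<lparr>verts = h ` verts A, part = part A \<circ> ?k, col = \<lambda>x y. col A (?k x) (?k y)\<rparr>"
  have "isomorphism h A ?A"
    using h by (auto simp: isomorphism_def embedding_def)
  then show ?thesis by blast
qed

section \<open>Omission of \<F> and the one-point extension property\<close>

definition omits :: "('w, 'c) lgraph set \<Rightarrow> ('v, 'c) lgraph \<Rightarrow> bool" where
  "omits \<F> A \<longleftrightarrow> (\<forall>B\<in>\<F>. \<not> embeds B A)"

lemma omits_pullback:
  assumes "omits \<F> B" "embedding f A B"
  shows "omits \<F> A"
  using assms embedding_comp unfolding omits_def embeds_def by blast

text \<open>\<open>Forb(\<F>)\<close> without the restriction to finite graphs on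
  \<open>nat\<close>, so that a countable graph \<open>G\<close> and its finite subgraphs fall under
  one notion.\<close>

definition admissible ::
  "nat \<Rightarrow> (nat \<Rightarrow> nat \<Rightarrow> 'c set) \<Rightarrow> (nat, 'c) lgraph set \<Rightarrow> ('v, 'c) lgraph \<Rightarrow> bool" where
  "admissible m C \<F> A \<longleftrightarrow> is_lgraph m C A \<and> omits \<F> A"

lemma admissible_pullback:
  "admissible m C \<F> B \<Longrightarrow> embedding f A B \<Longrightarrow> admissible m C \<F> A"
  unfolding admissible_def using is_lgraph_pullback omits_pullback by blast

lemma admissible_induced:
  "admissible m C \<F> G \<Longrightarrow> S \<subseteq> verts G \<Longrightarrow> admissible m C \<F> (induced G S)"
  using admissible_pullback embedding_id by blast

lemma forb_iff: "A \<in> forb m C \<F> \<longleftrightarrow> admissible m C \<F> A \<and> finite (verts A)"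
  by (auto simp: forb_def admissible_def omits_def)

text \<open>
  Extension graphs are taken on \<^typ>\<open>nat\<close> only, because a definition cannot quantify over types;
  every finite graph has a copy there, which lifts the property to all vertex types.
\<close>

definition realizes ::
  "nat \<Rightarrow> (nat \<Rightarrow> nat \<Rightarrow> 'c set) \<Rightarrow> (nat, 'c) lgraph set \<Rightarrow> ('v, 'c) lgraph \<Rightarrow> bool" where
  "realizes m C \<F> G \<longleftrightarrow>
     (\<forall>(A :: (nat, 'c) lgraph) a f.
        finite (verts A) \<and> admissible m C \<F> A \<and> a \<in> verts A \<and>
        embedding f (induced A (verts A - {a})) G \<longrightarrow>
        (\<exists>y. embedding (f(a := y)) A G))"

lemma realizes_point:
  fixes A :: "('u, 'c) lgraph"
  assumes G: "realizes m C \<F> G"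
    and A: "finite (verts A)" "admissible m C \<F> A" "a \<in> verts A"
    and f: "embedding f (induced A (verts A - {a})) G"
  shows "\<exists>y. embedding (f(a := y)) A G"
proof -
  obtain A' :: "(nat, 'c) lgraph" and h where h: "isomorphism h A A'"
    using finite_copy_on_nat A(1) by blast
  let ?k = "inv_into (verts A) h"
  have k: "isomorphism ?k A' A" using embedding_inv h by blast
  have inj: "inj_on h (verts A)" and im: "h ` verts A = verts A'"
    using h by (auto simp: isomorphism_def embedding_def)
  have "embedding ?k (induced A' (verts A' - {h a})) A"
    using k by (auto simp: isomorphism_def intro: embedding_induced)
  moreover have "?k ` (verts A' - {h a}) \<subseteq> verts A - {a}"
    using inj by (auto simp flip: im)
  ultimately have "embedding ?k (induced A' (verts A' - {h a})) (induced A (verts A - {a}))"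
    by (auto simp: embedding_def)
  then have "embedding (f \<circ> ?k) (induced A' (verts A' - {h a})) G"
    using f embedding_comp by blast
  moreover have "finite (verts A')" "h a \<in> verts A'"
    using im A(1,3) by (auto simp flip: im)
  moreover have "admissible m C \<F> A'"
    using admissible_pullback[OF A(2)] k by (auto simp: isomorphism_def)
  ultimately obtain y where y: "embedding ((f \<circ> ?k)(h a := y)) A' G"
    using G unfolding realizes_def by blast
  have "embedding ((f \<circ> ?k)(h a := y) \<circ> h) A G"
    using embedding_comp h y unfolding isomorphism_def by blast
  moreover have "((f \<circ> ?k)(h a := y) \<circ> h) x = (f(a := y)) x" if "x \<in> verts A" for x
    using that inj A(3) by (auto simp: inj_on_def)
  ultimately show ?thesis
    using embedding_cong[of A] by blast
qed

text \<open>The points of \<open>A\<close> outside \<open>S\<close> are added one at a time, each by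
  \<open>realizes_point\<close>. With \<open>S\<close> empty this embeds every finite admissible
  graph in \<open>G\<close>.\<close>

lemma realizes_extend:
  fixes A :: "('u, 'c) lgraph"
  assumes G: "realizes m C \<F> G"
    and A: "finite (verts A)" "admissible m C \<F> A" "S \<subseteq> verts A"
    and f: "embedding f (induced A S) G"
  shows "\<exists>g. embedding g A G \<and> (\<forall>x\<in>S. g x = f x)"
proof -
  have "finite T \<Longrightarrow> T \<subseteq> verts A \<Longrightarrow>
      \<exists>g. embedding g (induced A (S \<union> T)) G \<and> (\<forall>x\<in>S. g x = f x)" for T
  proof (induction T rule: finite_induct)
    case empty
    then show ?case using f by auto
  next
    case (insert t T)
    then obtain g where g: "embedding g (induced A (S \<union> T)) G" "\<forall>x\<in>S. g x = f x"
      by auto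
    show ?case
    proof (cases "t \<in> S")
      case True
      then show ?thesis using g by (metis Un_insert_right insert_absorb UnI1)
    next
      case False
      let ?B = "induced A (S \<union> insert t T)"
      have "verts ?B - {t} = S \<union> T" using False insert by auto
      then have "embedding g (induced ?B (verts ?B - {t})) G" using g by simp
      moreover have "finite (verts ?B)" "admissible m C \<F> ?B"
        using A insert finite_subset[OF A(3,1)] by (auto intro!: admissible_induced)
      ultimately obtain y where "embedding (g(t := y)) ?B G"
        using realizes_point[OF G, of ?B t g] by auto
      moreover have "\<forall>x\<in>S. (g(t := y)) x = f x" using g(2) False by auto
      ultimately show ?thesis by blast
    qed
  qed
  from this[OF A(1)] show ?thesis using A(3) by (simp add: Un_absorb1)
qed

text \<open>As \<open>A\<close> lies in the age, some \<open>e\<close> embeds it in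
  \<open>G\<close>. On \<open>A\<close> without \<open>a\<close> the maps \<open>e\<close> and
  \<open>f\<close> differ by an isomorphism between finite induced subgraphs of \<open>G\<close>; an
  automorphism \<open>s\<close> extending it moves \<open>e a\<close> to the required point.\<close>

lemma homogeneous_imp_realizes:
  assumes "homogeneous G" and age: "age m C G = forb m C \<F>"
  shows "realizes m C \<F> G"
  unfolding realizes_def
proof (intro allI impI, elim conjE)
  fix A :: "(nat, 'b) lgraph" and a f
  let ?S = "verts A - {a}"
  assume A: "finite (verts A)" "admissible m C \<F> A" "a \<in> verts A"
    and f: "embedding f (induced A ?S) G"
  then have "A \<in> age m C G" using age by (simp add: forb_iff)
  then obtain e where e: "embedding e A G" by (auto simp: age_def embeds_def)
  have e': "embedding e (induced A ?S) G" using e by (auto intro: embedding_induced)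
  then have "isomorphism e (induced A ?S) (induced G (e ` ?S))"
    by (auto simp: isomorphism_def embedding_def)
  from embedding_inv[OF this]
  have k: "embedding (inv_into ?S e) (induced G (e ` ?S)) (induced A ?S)"
    and kim: "inv_into ?S e ` e ` ?S = ?S"
    by (auto simp: isomorphism_def)
  have "embedding (f \<circ> inv_into ?S e) (induced G (e ` ?S)) G"
    using embedding_comp[OF k f] .
  then have "isomorphism (f \<circ> inv_into ?S e) (induced G (e ` ?S)) (induced G (f ` ?S))"
    using image_comp[of f "inv_into ?S e" "e ` ?S"] kim
    by (simp add: isomorphism_def embedding_def del: image_comp)
  moreover have "finite (e ` ?S)" "e ` ?S \<subseteq> verts G" "finite (f ` ?S)" "f ` ?S \<subseteq> verts G"
    using A(1) e' f by (auto simp: embedding_def)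
  ultimately have "\<exists>s. isomorphism s G G \<and> (\<forall>x\<in>e ` ?S. s x = (f \<circ> inv_into ?S e) x)"
    using assms(1)[unfolded homogeneous_def, rule_format, of "e ` ?S" "f ` ?S" "f \<circ> inv_into ?S e"]
    by simp
  then obtain s where s: "isomorphism s G G"
      "\<And>x. x \<in> e ` ?S \<Longrightarrow> s x = (f \<circ> inv_into ?S e) x"
    by metis
  have "embedding (s \<circ> e) A G"
    using s(1) by (auto simp: isomorphism_def intro: embedding_comp[OF e])
  moreover have "(s \<circ> e) x = (f(a := s (e a))) x" if "x \<in> verts A" for x
  proof (cases "x = a")
    case False
    have "inj_on e ?S" using e' by (simp add: embedding_def)
    then show ?thesis using s(2)[of "e x"] that False by (simp add: inv_into_f_f)
  qed simp
  ultimately show "\<exists>y. embedding (f(a := y)) A G"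
    using embedding_cong[of A] by blast
qed

section \<open>Partial isomorphisms and back-and-forth\<close>

definition partial_iso :: "('v, 'c) lgraph \<Rightarrow> ('w, 'c) lgraph \<Rightarrow> ('v \<times> 'w) set \<Rightarrow> bool" where
  "partial_iso G H R \<longleftrightarrow> R \<subseteq> verts G \<times> verts H \<and>
     (\<forall>x y. (x, y) \<in> R \<longrightarrow> part G x = part H y) \<and>
     (\<forall>x y x' y'. (x, y) \<in> R \<and> (x', y') \<in> R \<longrightarrow>
        (x = x' \<longleftrightarrow> y = y') \<and> (part G x \<noteq> part G x' \<longrightarrow> col G x x' = col H y y'))"

text \<open>The relational form of \<open>partial_iso\<close> treats both graphs alike, so that the
  step back becomes the step forth for the converse.\<close>

lemma partial_iso_converse:
  assumes "partial_iso G H R"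
  shows "partial_iso H G (R\<inverse>)"
proof -
  have "col H y y' = col G x x'" if "(x, y) \<in> R" "(x', y') \<in> R" "part H y \<noteq> part H y'" for x y x' y'
    using assms that unfolding partial_iso_def by metis
  then show ?thesis
    using assms unfolding partial_iso_def by (auto 0 3)
qed

lemma partial_iso_of_embedding:
  assumes "embedding f (induced G S) H" "S \<subseteq> verts G"
  shows "partial_iso G H ((\<lambda>x. (x, f x)) ` S)"
  using assms unfolding partial_iso_def embedding_def by (auto simp: inj_on_def)

lemma embedding_of_partial_iso:
  assumes R: "partial_iso G H R"
  obtains f where "embedding f (induced G (Domain R)) H" "R = (\<lambda>x. (x, f x)) ` Domain R"
proof -
  define f where "f x = (SOME y. (x, y) \<in> R)" for x
  have f: "(x, f x) \<in> R" if "x \<in> Domain R" for x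
    using that unfolding f_def by (auto intro: someI)
  have uniq: "y = f x" if "(x, y) \<in> R" for x y
    using that f[of x] R unfolding partial_iso_def by (metis DomainI)
  have "embedding f (induced G (Domain R)) H"
    unfolding embedding_def induced_simps
  proof (intro conjI ballI impI)
    show "inj_on f (Domain R)"
      using f R unfolding partial_iso_def inj_on_def by metis
    show "f ` Domain R \<subseteq> verts H"
      using f R unfolding partial_iso_def by fast
    show "part H (f x) = part G x" if "x \<in> Domain R" for x
      using f[OF that] R unfolding partial_iso_def by metis
    show "col H (f x) (f y) = col G x y"
      if "x \<in> Domain R" "y \<in> Domain R" "part G x \<noteq> part G y" for x y
      using f[OF that(1)] f[OF that(2)] that R unfolding partial_iso_def by metis
  qed
  moreover have "R = (\<lambda>x. (x, f x)) ` Domain R"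
    using f uniq by auto
  ultimately show ?thesis using that by blast
qed

text \<open>The finite graph induced on \<open>Domain R\<close> and \<open>x\<close> is admissible
  as a subgraph of \<open>G\<close>, so the extension property of \<open>H\<close> supplies an image
  for \<open>x\<close>.\<close>

lemma partial_iso_forth:
  assumes R: "partial_iso G H R" "finite R"
    and G: "admissible m C \<F> G" and H: "realizes m C \<F> H" and x: "x \<in> verts G"
  shows "\<exists>R'. partial_iso G H R' \<and> finite R' \<and> R \<subseteq> R' \<and> x \<in> Domain R'"
proof -
  obtain f where f: "embedding f (induced G (Domain R)) H" "R = (\<lambda>x. (x, f x)) ` Domain R"
    using embedding_of_partial_iso R(1) by blast
  have sub: "insert x (Domain R) \<subseteq> verts G"
    using R(1) x by (auto simp: partial_iso_def)
  obtain g where g: "embedding g (induced G (insert x (Domain R))) H" "\<forall>x\<in>Domain R. g x = f x"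
    using realizes_extend[OF H, of "induced G (insert x (Domain R))" "Domain R" f]
      f(1) R(2) admissible_induced[OF G sub] by (auto simp: finite_Domain)
  let ?R = "(\<lambda>x. (x, g x)) ` insert x (Domain R)"
  have "partial_iso G H ?R" using partial_iso_of_embedding[OF g(1) sub] .
  moreover have "R \<subseteq> ?R" using f(2) g(2) by auto
  moreover have "finite ?R" using R(2) by (simp add: finite_Domain)
  ultimately show ?thesis by (intro exI[of _ ?R]) auto
qed

lemma partial_iso_back:
  assumes R: "partial_iso G H R" "finite R"
    and H: "admissible m C \<F> H" and G: "realizes m C \<F> G" and y: "y \<in> verts H"
  shows "\<exists>R'. partial_iso G H R' \<and> finite R' \<and> R \<subseteq> R' \<and> y \<in> Range R'"
proof -
  obtain R' where R': "partial_iso H G R'" "finite R'" "R\<inverse> \<subseteq> R'" "y \<in> Domain R'"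
    using partial_iso_forth[OF partial_iso_converse[OF R(1)] _ H G y] R(2) by auto
  then show ?thesis
    using partial_iso_converse[OF R'(1)] by (intro exI[of _ "R'\<inverse>"]) auto
qed

text \<open>A chain of finite partial isomorphisms is built whose \<open>n\<close>-th step catches
  the \<open>n\<close>-th vertex of \<open>G\<close> in the domain and the \<open>n\<close>-th
  vertex of \<open>H\<close> in the range; its union is the graph of \<open>f\<close>. The start
  \<open>R\<^sub>0\<close> is left free: a finite isomorphism inside one graph gives homogeneity,
  the empty relation gives uniqueness.\<close>

lemma back_and_forth:
  assumes G: "countable (verts G)" "admissible m C \<F> G" "realizes m C \<F> G"
    and H: "countable (verts H)" "admissible m C \<F> H" "realizes m C \<F> H"
    and R\<^sub>0: "partial_iso G H R\<^sub>0" "finite R\<^sub>0"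
  obtains f where "isomorphism f G H" "\<And>x y. (x, y) \<in> R\<^sub>0 \<Longrightarrow> f x = y"
proof -
  define P where "P n R \<longleftrightarrow> partial_iso G H R \<and> finite R \<and> R\<^sub>0 \<subseteq> R" for n :: nat and R
  \<comment> \<open>\<open>from_nat_into\<close> has an unspecified value on the empty set, hence
    the membership premises.\<close>
  define Q where "Q n R R' \<longleftrightarrow> R \<subseteq> R' \<and>
      (from_nat_into (verts G) n \<in> verts G \<longrightarrow> from_nat_into (verts G) n \<in> Domain R') \<and>
      (from_nat_into (verts H) n \<in> verts H \<longrightarrow> from_nat_into (verts H) n \<in> Range R')" for n R R'
  have "\<exists>S. \<forall>n. P n (S n) \<and> Q n (S n) (S (Suc n))"
  proof (rule dependent_nat_choice)
    show "\<exists>R. P 0 R" using R\<^sub>0 by (auto simp: P_def)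
  next
    fix R n assume "P n R"
    then have R: "partial_iso G H R" "finite R" "R\<^sub>0 \<subseteq> R" by (auto simp: P_def)
    obtain R1 where R1: "partial_iso G H R1" "finite R1" "R \<subseteq> R1"
      "from_nat_into (verts G) n \<in> verts G \<longrightarrow> from_nat_into (verts G) n \<in> Domain R1"
      using partial_iso_forth[OF R(1,2) G(2) H(3), of "from_nat_into (verts G) n"] R by blast
    obtain R2 where "partial_iso G H R2" "finite R2" "R1 \<subseteq> R2"
      "from_nat_into (verts H) n \<in> verts H \<longrightarrow> from_nat_into (verts H) n \<in> Range R2"
      using partial_iso_back[OF R1(1,2) H(2) G(3), of "from_nat_into (verts H) n"] R1 by blast
    then have "P (Suc n) R2 \<and> Q n R R2"
      using R R1 unfolding P_def Q_def by blast
    then show "\<exists>R'. P (Suc n) R' \<and> Q n R R'" by blast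
  qed
  then obtain S where S: "\<And>n. P n (S n)" "\<And>n. Q n (S n) (S (Suc n))" by blast
  have mono: "S i \<subseteq> S j" if "i \<le> j" for i j
    using that by (rule lift_Suc_mono_le[rotated]) (use S(2) in \<open>auto simp: Q_def\<close>)
  let ?U = "\<Union>n. S n"
  have U: "partial_iso G H ?U"
    unfolding partial_iso_def
  proof (intro conjI allI impI)
    show "?U \<subseteq> verts G \<times> verts H"
      using S(1) unfolding P_def partial_iso_def by blast
    show "part G x = part H y" if "(x, y) \<in> ?U" for x y
      using that S(1) unfolding P_def partial_iso_def by blast
    fix x y x' y' assume "(x, y) \<in> ?U \<and> (x', y') \<in> ?U"
    then obtain i j where "(x, y) \<in> S i" "(x', y') \<in> S j" by blast
    then have "(x, y) \<in> S (max i j)" "(x', y') \<in> S (max i j)"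
      using mono[of i "max i j"] mono[of j "max i j"] by auto
    moreover have "partial_iso G H (S (max i j))" using S(1) by (simp add: P_def)
    ultimately show "x = x' \<longleftrightarrow> y = y'" "part G x \<noteq> part G x' \<Longrightarrow> col G x x' = col H y y'"
      unfolding partial_iso_def by blast+
  qed
  have "x \<in> Domain ?U" if "x \<in> verts G" for x
  proof -
    obtain n where "from_nat_into (verts G) n = x" using from_nat_into_surj[OF G(1) \<open>x \<in> verts G\<close>] ..
    then show ?thesis using S(2)[of n] that unfolding Q_def by blast
  qed
  then have dom: "Domain ?U = verts G" using U by (auto simp: partial_iso_def)
  have "y \<in> Range ?U" if "y \<in> verts H" for y
  proof -
    obtain n where "from_nat_into (verts H) n = y" using from_nat_into_surj[OF H(1) \<open>y \<in> verts H\<close>] ..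
    then show ?thesis using S(2)[of n] that unfolding Q_def by blast
  qed
  then have ran: "Range ?U = verts H" using U by (auto simp: partial_iso_def)
  obtain f where f: "embedding f (induced G (Domain ?U)) H" "?U = (\<lambda>x. (x, f x)) ` Domain ?U"
    using embedding_of_partial_iso U by blast
  have "f ` verts G = Range ?U" by (subst f(2), unfold dom) force
  then have "isomorphism f G H"
    using f(1) dom ran by (simp add: isomorphism_def)
  moreover have "f x = y" if "(x, y) \<in> R\<^sub>0" for x y
  proof -
    have "(x, y) \<in> ?U" using that S(1)[of 0] by (auto simp: P_def)
    then show ?thesis by (subst (asm) f(2)) auto
  qed
  ultimately show ?thesis using that by blast
qed

lemma realizes_imp_homogeneous:
  assumes "countable (verts G)" "admissible m C \<F> G" "realizes m C \<F> G"
  shows "homogeneous G"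
  unfolding homogeneous_def
proof (intro allI impI, elim conjE)
  fix S T f
  assume S: "finite S" "S \<subseteq> verts G" and T: "T \<subseteq> verts G"
    and "isomorphism f (induced G S) (induced G T)"
  then have "embedding f (induced G S) G"
    by (auto simp: isomorphism_def embedding_def)
  then have "partial_iso G G ((\<lambda>x. (x, f x)) ` S)"
    using partial_iso_of_embedding S(2) by blast
  then obtain g where "isomorphism g G G" "\<And>x y. (x, y) \<in> (\<lambda>x. (x, f x)) ` S \<Longrightarrow> g x = y"
    using back_and_forth[OF assms assms] S(1) by blast
  then show "\<exists>g. isomorphism g G G \<and> (\<forall>x\<in>S. g x = f x)" by blast
qed

lemma realizes_imp_age:
  fixes G :: "('v, 'c) lgraph"
  assumes "admissible m C \<F> G" "realizes m C \<F> G"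
  shows "age m C G = forb m C \<F>"
proof (rule set_eqI)
  fix A :: "(nat, 'c) lgraph"
  have "embeds A G" if "admissible m C \<F> A" "finite (verts A)"
    using realizes_extend[OF assms(2) that(2,1), of "{}" undefined]
    by (auto simp: embedding_def embeds_def)
  moreover have "admissible m C \<F> A" if "embeds A G"
    using that admissible_pullback[OF assms(1)] by (auto simp: embeds_def)
  moreover have "is_lgraph m C A" if "admissible m C \<F> A"
    using that by (simp add: admissible_def)
  ultimately show "A \<in> age m C G \<longleftrightarrow> A \<in> forb m C \<F>"
    unfolding forb_iff age_def by blast
qed

section \<open>Forbidden triangles\<close>

lemma monic_inj_part: "monic m C B \<Longrightarrow> inj_on (part B) (verts B)"
proof (rule inj_onI)
  fix x y assume B: "monic m C B" and xy: "x \<in> verts B" "y \<in> verts B" "part B x = part B y"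
  then have "part B x < m" "finite (part_set B (part B x))"
    by (auto simp: monic_def is_lgraph_def part_set_def)
  moreover from this B have "card (part_set B (part B x)) \<le> 1" by (simp add: monic_def)
  ultimately show "x = y"
    using xy by (auto simp: part_set_def card_le_Suc0_iff_eq)
qed

text \<open>Three colours determine a triangle up to isomorphism; the reversed edges follow from the
  symmetry of \<open>col\<close> in \<open>B\<close> and in \<open>X\<close>, which is why both must
  be L-graphs.\<close>

lemma triangle_embeds:
  assumes B: "is_lgraph m C B" "triangle p q r B"
    and edges: "edge_coloured B p q (col X x y)" "edge_coloured B p r (col X x z)"
      "edge_coloured B q r (col X y z)"
    and X: "is_lgraph m C X" "x \<in> verts X" "y \<in> verts X" "z \<in> verts X"
      "part X x = p" "part X y = q" "part X z = r"
    and distinct: "p \<noteq> q" "p \<noteq> r" "q \<noteq> r"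
  shows "embeds B X"
proof -
  obtain a b c where abc: "part_set B p = {a}" "part_set B q = {b}" "part_set B r = {c}"
    using B(2) by (auto simp: triangle_def card_1_singleton_iff)
  have "v \<in> {a, b, c}" if "v \<in> verts B" for v
  proof -
    have "v \<in> part_set B (part B v)" using that by (simp add: part_set_def)
    then have "part B v \<in> {p, q, r}" using B(2) unfolding triangle_def by (metis empty_iff)
    then show ?thesis using \<open>v \<in> part_set B (part B v)\<close> abc by auto
  qed
  then have verts: "verts B = {a, b, c}" using abc by (auto simp: part_set_def)
  have part: "part B a = p" "part B b = q" "part B c = r" using abc by (auto simp: part_set_def)
  have col: "col B a b = col X x y" "col B a c = col X x z" "col B b c = col X y z"
    using edges abc by (auto simp: edge_coloured_def)
  have colB: "col B b a = col B a b" "col B c a = col B a c" "col B c b = col B b c"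
    using verts part distinct by (auto intro!: lgraph_col_commute[OF B(1)])
  have colX: "col X y x = col X x y" "col X z x = col X x z" "col X z y = col X y z"
    using X distinct by (auto intro!: lgraph_col_commute[OF X(1)])
  have "embedding (\<lambda>v. if v = a then x else if v = b then y else z) B X"
    unfolding embedding_def verts using X part col colB colX distinct
    by (auto simp: inj_on_def)
  then show ?thesis by (auto simp: embeds_def)
qed

lemma edge_coloured_embedding:
  assumes "embedding f B X" "v \<in> verts B" "w \<in> verts B" "part B v \<noteq> part B w"
  shows "edge_coloured B (part B v) (part B w) (col X (f v) (f w))"
  using assms by (auto simp: edge_coloured_def embedding_def part_set_def)

text \<open>The colours are listed in the order \<open>pq\<close>, \<open>pr\<close>, \<open>qr\<close>.\<close>

definition forbidden_triangle ::
  "('v, 'c) lgraph set \<Rightarrow> nat \<Rightarrow> nat \<Rightarrow> nat \<Rightarrow> 'c \<Rightarrow> 'c \<Rightarrow> 'c \<Rightarrow> bool" where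
  "forbidden_triangle \<F> p q r a b c \<longleftrightarrow>
     (\<exists>B\<in>\<F>. triangle p q r B \<and> edge_coloured B p q a \<and> edge_coloured B p r b \<and> edge_coloured B q r c)"

definition add_vertex ::
  "('v, 'c) lgraph \<Rightarrow> 'v \<Rightarrow> nat \<Rightarrow> ('v \<Rightarrow> 'c) \<Rightarrow> ('v, 'c) lgraph" where
  "add_vertex G z i g =
     \<lparr>verts = insert z (verts G), part = (part G)(z := i),
      col = \<lambda>x y. if x = z then g y else if y = z then g x else col G x y\<rparr>"

lemma add_vertex_simps [simp]:
  "verts (add_vertex G z i g) = insert z (verts G)"
  "part (add_vertex G z i g) x = (if x = z then i else part G x)"
  "col (add_vertex G z i g) x y = (if x = z then g y else if y = z then g x else col G x y)"
  by (simp_all add: add_vertex_def)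

lemma distinct_indices_exist:
  assumes "i < 4" "j < 4" "i \<noteq> j"
  shows "\<exists>k l. distinct_indices i j k l"
proof -
  have "card ({0, 1, 2, 3} - {i, j}) = 2"
    using assms by (subst card_Diff_subset) (auto simp: numeral_eq_Suc less_Suc_eq)
  then obtain k l where kl: "k \<noteq> l" "{0, 1, 2, 3} - {i, j} = {k, l}" by (auto simp: card_2_iff)
  moreover have "{i, j} \<subseteq> {0, 1, 2, 3}" using assms by auto
  ultimately have "{i, j, k, l} = {0, 1, 2, 3}" by (metis Un_Diff_cancel Un_absorb1 Un_insert_left sup_bot_left)
  moreover have "k \<notin> {i, j}" "l \<notin> {i, j}" using kl by blast+
  ultimately have "distinct_indices i j k l"
    using assms(3) kl(1) unfolding distinct_indices_def by auto
  then show ?thesis by blast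
qed

lemma distinct_indices_perm:
  "distinct_indices i j k l \<Longrightarrow> distinct_indices k l i j"
proof -
  have "{k, l, i, j} = {i, j, k, l}" by blast
  then show "distinct_indices i j k l \<Longrightarrow> distinct_indices k l i j"
    unfolding distinct_indices_def by auto
qed

lemma distinct_indices_bound:
  "distinct_indices i j k l \<Longrightarrow> i < 4 \<and> j < 4 \<and> k < 4 \<and> l < 4"
proof -
  assume "distinct_indices i j k l"
  then have *: "p \<in> {0, 1, 2, 3}" if "p \<in> {i, j, k, l}" for p
    using that by (simp add: distinct_indices_def)
  have "p < 4" if "p \<in> {i, j, k, l}" for p using *[OF that] by auto
  then show ?thesis by blast
qed

lemma distinct_indices_cases:
  assumes "distinct_indices i j k l" "p < 4"
  shows "p \<in> {i, j, k, l}"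
proof -
  have "p \<in> {0, 1, 2, 3}" using assms(2) by auto
  then show ?thesis using assms(1) by (simp add: distinct_indices_def)
qed

section \<open>Monics meeting few parts, and the conditions in terms of forbidden triangles\<close>

locale quadripartite =
  fixes C :: "nat \<Rightarrow> nat \<Rightarrow> 'c set" and \<F> :: "(nat, 'c) lgraph set"
  assumes language: "language 4 C"
    and monics: "\<And>A. A \<in> \<F> \<Longrightarrow> monic 4 C A"
begin

lemma C_commute: "i < 4 \<Longrightarrow> j < 4 \<Longrightarrow> i \<noteq> j \<Longrightarrow> C i j = C j i"
  and C_finite: "i < 4 \<Longrightarrow> j < 4 \<Longrightarrow> i \<noteq> j \<Longrightarrow> finite (C i j)"
  and C_nonempty: "i < 4 \<Longrightarrow> j < 4 \<Longrightarrow> i \<noteq> j \<Longrightarrow> C i j \<noteq> {}"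
  using language by (simp_all add: language_def)

lemma lgraphs: "A \<in> \<F> \<Longrightarrow> is_lgraph 4 C A"
  using monics by (simp add: monic_def)

abbreviation adm :: "('v, 'c) lgraph \<Rightarrow> bool" where
  "adm \<equiv> admissible 4 C \<F>"

abbreviation forbtri :: "nat \<Rightarrow> nat \<Rightarrow> nat \<Rightarrow> 'c \<Rightarrow> 'c \<Rightarrow> 'c \<Rightarrow> bool" where
  "forbtri \<equiv> forbidden_triangle \<F>"

lemma admissible_no_forbidden_triangle:
  assumes "adm X" "x \<in> verts X" "y \<in> verts X" "z \<in> verts X"
    "part X x = p" "part X y = q" "part X z = r" "p \<noteq> q" "p \<noteq> r" "q \<noteq> r"
  shows "\<not> forbtri p q r (col X x y) (col X x z) (col X y z)"
proof
  assume "forbtri p q r (col X x y) (col X x z) (col X y z)"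
  then obtain B where B: "B \<in> \<F>" "triangle p q r B" "edge_coloured B p q (col X x y)"
    "edge_coloured B p r (col X x z)" "edge_coloured B q r (col X y z)"
    by (auto simp: forbidden_triangle_def)
  have "embeds B X"
    by (rule triangle_embeds[OF lgraphs[OF B(1)] B(2-5)]) (use assms in \<open>auto simp: admissible_def\<close>)
  then show False using assms(1) B(1) by (auto simp: admissible_def omits_def)
qed

lemma small_part_image:
  assumes "no_small_members \<F>" "B \<in> \<F>"
  shows "3 \<le> card (part B ` verts B)"
  using assms monic_inj_part[OF monics[OF assms(2)]]
  by (simp add: no_small_members_def card_image)

text \<open>A member of \<F> meets as many parts as it has vertices, hence at least three.\<close>

lemma omits_two_parts:
  assumes "no_small_members \<F>" "\<And>v. v \<in> verts X \<Longrightarrow> part X v \<in> {p, q}"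
  shows "omits \<F> X"
  unfolding omits_def embeds_def
proof (intro ballI notI, elim exE)
  fix B f assume B: "B \<in> \<F>" and f: "embedding f B X"
  then have "part B ` verts B \<subseteq> {p, q}"
    using assms(2) by (force simp: embedding_def)
  then have "card (part B ` verts B) \<le> card {p, q}" by (intro card_mono) auto
  also have "\<dots> \<le> 2" by (simp add: card_insert_if)
  finally show False using small_part_image[OF assms(1) B] by simp
qed

text \<open>A monic with at least three vertices, all in parts \<open>p\<close>, \<open>q\<close>,
  \<open>r\<close>, has exactly one in each, so among the members of \<F> only
  \<open>pqr\<close>-triangles can embed.\<close>

lemma omits_three_parts:
  assumes small: "no_small_members \<F>" and distinct: "p \<noteq> q" "p \<noteq> r" "q \<noteq> r"
    and parts: "\<And>v. v \<in> verts X \<Longrightarrow> part X v \<in> {p, q, r}"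
    and triangles: "\<And>x y z. \<lbrakk>x \<in> verts X; y \<in> verts X; z \<in> verts X;
      part X x = p; part X y = q; part X z = r\<rbrakk> \<Longrightarrow>
      \<not> forbtri p q r (col X x y) (col X x z) (col X y z)"
  shows "omits \<F> X"
  unfolding omits_def embeds_def
proof (intro ballI notI, elim exE)
  fix B f assume B: "B \<in> \<F>" and f: "embedding f B X"
  have sub: "part B ` verts B \<subseteq> {p, q, r}"
    using parts f by (force simp: embedding_def)
  have "card {p, q, r} = 3" using distinct by simp
  then have im: "part B ` verts B = {p, q, r}"
    using small_part_image[OF small B] sub by (intro card_seteq) auto
  have singleton: "\<exists>a. part_set B s = {a}" if "s \<in> {p, q, r}" for s
  proof -
    obtain a where a: "a \<in> verts B" "part B a = s" using im \<open>s \<in> {p, q, r}\<close> by (metis imageE)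
    then have "part_set B s = {a}"
      using monic_inj_part[OF monics[OF B]] by (auto simp: part_set_def inj_on_def)
    then show ?thesis ..
  qed
  have "triangle p q r B"
    unfolding triangle_def
  proof (intro conjI ballI allI impI)
    show "card (part_set B s) = 1" if "s \<in> {p, q, r}" for s using singleton[OF that] by auto
    show "part_set B s = {}" if "s \<notin> {p, q, r}" for s using im that by (auto simp: part_set_def)
  qed
  moreover obtain a b c where abc: "a \<in> verts B" "part B a = p" "b \<in> verts B" "part B b = q"
      "c \<in> verts B" "part B c = r"
  proof -
    have "p \<in> part B ` verts B" "q \<in> part B ` verts B" "r \<in> part B ` verts B" using im by auto
    then show ?thesis using that by (auto simp: image_iff)
  qed
  then have "edge_coloured B p q (col X (f a) (f b))" "edge_coloured B p r (col X (f a) (f c))"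
      "edge_coloured B q r (col X (f b) (f c))"
    using edge_coloured_embedding[OF f] distinct by metis+
  ultimately have "forbtri p q r (col X (f a) (f b)) (col X (f a) (f c)) (col X (f b) (f c))"
    using B by (auto simp: forbidden_triangle_def)
  moreover have "f a \<in> verts X" "part X (f a) = p" "f b \<in> verts X" "part X (f b) = q"
      "f c \<in> verts X" "part X (f c) = r"
    using abc f by (auto simp: embedding_def)
  ultimately show False using triangles by blast
qed

text \<open>Among the subsets of \<F> compatible with a code, that of all compatible members is the
  largest, so it covers \<open>C i j\<close> if any does. The quantifier over sets of graphs thus
  becomes a statement about single colours.\<close>

lemma omission_set_iff:
  "(\<exists>\<B>\<subseteq>\<F>. omission_set 4 C i j k l cik cil cjk cjl \<B>) \<longleftrightarrow>
     cik \<in> C i k \<and> cil \<in> C i l \<and> cjk \<in> C j k \<and> cjl \<in> C j l \<and>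
     (\<forall>c\<in>C i j. forbtri i j k c cik cjk \<or> forbtri i j l c cil cjl)"
  (is "?L \<longleftrightarrow> ?R")
proof
  assume ?L
  then show ?R
    unfolding omission_set_def cover_set_def forbidden_triangle_def by (meson subsetD)
next
  assume R: ?R
  let ?B = "{A \<in> \<F>. (triangle i j k A \<and> edge_coloured A i k cik \<and> edge_coloured A j k cjk) \<or>
              (triangle i j l A \<and> edge_coloured A i l cil \<and> edge_coloured A j l cjl)}"
  have "omission_set 4 C i j k l cik cil cjk cjl ?B"
    using R monics unfolding omission_set_def cover_set_def forbidden_triangle_def by auto
  then show ?L by (intro exI[of _ ?B]) auto
qed

text \<open>Both omission sets have the same code, so by the symmetry of \<open>C\<close> their
  requirements on the four colours agree, and only the two covering statements remain.\<close>

lemma omission_condition_iff: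
  "omission_condition C \<F> \<longleftrightarrow>
    (\<forall>i j k l cik cil cjk cjl. distinct_indices i j k l \<and>
       cik \<in> C i k \<and> cil \<in> C i l \<and> cjk \<in> C j k \<and> cjl \<in> C j l \<and>
       (\<forall>c\<in>C i j. forbtri i j k c cik cjk \<or> forbtri i j l c cil cjl) \<longrightarrow>
       (\<forall>c\<in>C k l. forbtri k l i c cik cil \<or> forbtri k l j c cjk cjl))"
  (is "_ \<longleftrightarrow> ?R")
proof -
  have "omission_condition C \<F> \<longleftrightarrow>
    (\<forall>i j k l cik cil cjk cjl. distinct_indices i j k l \<and>
       (\<exists>\<B>\<subseteq>\<F>. omission_set 4 C i j k l cik cil cjk cjl \<B>) \<longrightarrow>
       (\<exists>\<B>\<subseteq>\<F>. omission_set 4 C k l i j cik cjk cil cjl \<B>))"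
    unfolding omission_condition_def corresponding_omission_set_def by (intro iff_allI) blast
  also have "\<dots> \<longleftrightarrow> ?R"
  proof -
    have sym: "C k i = C i k" "C l i = C i l" "C k j = C j k" "C l j = C j l"
      if "distinct_indices i j k l" for i j k l
      using distinct_indices_bound[OF that] that[unfolded distinct_indices_def]
      by - (rule C_commute; simp)+
    show ?thesis
      unfolding omission_set_iff
    proof (intro iff_allI)
      fix i j k l cik cil cjk cjl
      show "(distinct_indices i j k l \<and>
           cik \<in> C i k \<and> cil \<in> C i l \<and> cjk \<in> C j k \<and> cjl \<in> C j l \<and>
           (\<forall>c\<in>C i j. forbtri i j k c cik cjk \<or> forbtri i j l c cil cjl) \<longrightarrow>
           cik \<in> C k i \<and> cjk \<in> C k j \<and> cil \<in> C l i \<and> cjl \<in> C l j \<and>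
           (\<forall>c\<in>C k l. forbtri k l i c cik cil \<or> forbtri k l j c cjk cjl)) =
         (distinct_indices i j k l \<and>
           cik \<in> C i k \<and> cil \<in> C i l \<and> cjk \<in> C j k \<and> cjl \<in> C j l \<and>
           (\<forall>c\<in>C i j. forbtri i j k c cik cjk \<or> forbtri i j l c cil cjl) \<longrightarrow>
           (\<forall>c\<in>C k l. forbtri k l i c cik cil \<or> forbtri k l j c cjk cjl))"
      proof (cases "distinct_indices i j k l")
        case True
        then show ?thesis unfolding sym[OF True] by argo
      qed blast
    qed
  qed
  finally show ?thesis .
qed

lemma omission_conditionD:
  assumes "omission_condition C \<F>" "distinct_indices i j k l"
    "cik \<in> C i k" "cil \<in> C i l" "cjk \<in> C j k" "cjl \<in> C j l"
    "\<And>c. c \<in> C i j \<Longrightarrow> forbtri i j k c cik cjk \<or> forbtri i j l c cil cjl"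
    "c \<in> C k l"
  shows "forbtri k l i c cik cil \<or> forbtri k l j c cjk cjl"
  using assms unfolding omission_condition_iff by blast

text \<open>The amalgamation argument inside \<open>G\<close>: \<open>R\<close> records two
  one-point extensions of a common finite graph, and its own colour for \<open>xy\<close> is
  disregarded, since neither of the two induced graphs contains that edge. One copy of the common
  graph serves both extensions, and \<open>G\<close> itself then decides how \<open>h x\<close> and
  \<open>h y\<close> are joined.\<close>

lemma realizes_two_points:
  fixes R :: "('u, 'c) lgraph" and G :: "('v, 'c) lgraph"
  assumes G: "realizes 4 C \<F> G"
    and R: "finite (verts R)" "x \<in> verts R" "y \<in> verts R" "x \<noteq> y"
    and x: "adm (induced R (verts R - {x}))" and y: "adm (induced R (verts R - {y}))"
  obtains h where "embedding h (induced R (verts R - {x})) G" "embedding h (induced R (verts R - {y})) G"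
proof -
  obtain g where g: "embedding g (induced R (verts R - {y})) G"
    using realizes_extend[OF G _ y, of "{}" undefined] R(1) by (auto simp: embedding_def)
  let ?A = "induced R (verts R - {x})"
  have "embedding g (induced R (verts R - {x} - {y})) G"
    using embedding_induced[OF g, of "verts R - {x} - {y}"] by auto
  then obtain y' where y': "embedding (g(y := y')) ?A G"
    using realizes_point[OF G _ x, of y g] R by auto
  have "embedding (g(y := y')) (induced R (verts R - {y})) G"
    using g by (subst embedding_cong[where g = g]) auto
  with y' show ?thesis using that by blast
qed

text \<open>The vertices of a two-vertex monic lie in different parts, so the extension property
  over a single vertex produces its edge; for a single vertex a nonempty part is enough.\<close>

lemma generic_imp_no_small_members:
  assumes gen: "generic 4 C G" and G: "adm G"
  shows "no_small_members \<F>"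
  unfolding no_small_members_def
proof (rule ballI, rule ccontr)
  fix B assume B: "B \<in> \<F>" and "\<not> 3 \<le> card (verts B)"
  then have "card (verts B) \<in> {0, 1, 2}" by auto
  moreover have "finite (verts B)" using monics[OF B] by (simp add: monic_def)
  ultimately consider "verts B = {}" | a where "verts B = {a}" | a b where "a \<noteq> b" "verts B = {a, b}"
    by (auto simp: card_1_singleton_iff card_2_iff numeral_2_eq_2[symmetric])
  then have "embeds B G"
  proof cases
    case 1
    then show ?thesis by (auto simp: embeds_def embedding_def)
  next
    case 2
    then have "part B a < 4" using lgraphs[OF B] by (auto simp: is_lgraph_def)
    then obtain x where "x \<in> part_set G (part B a)"
      using gen unfolding generic_def by (metis finite.emptyI ex_in_conv)
    then have "embedding (\<lambda>_. x) B G" using 2 by (auto simp: embedding_def part_set_def)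
    then show ?thesis by (auto simp: embeds_def)
  next
    case 3
    then have ab: "part B a < 4" "part B b < 4" using lgraphs[OF B] by (auto simp: is_lgraph_def)
    have ne: "part B a \<noteq> part B b"
      using 3 monic_inj_part[OF monics[OF B]] by (auto simp: inj_on_def)
    then have c: "col B b a = col B a b" "col B a b \<in> C (part B a) (part B b)"
      using 3 lgraph_col_commute[OF lgraphs[OF B], of b a] lgraph_col_in[OF lgraphs[OF B], of a b]
      by simp_all
    obtain x where x: "x \<in> part_set G (part B a)"
      using gen ab unfolding generic_def by (metis finite.emptyI ex_in_conv)
    have "\<exists>y\<in>part_set G (part B b). \<forall>u\<in>{x}. col G y u = (\<lambda>_. col B a b) u"
      using gen[unfolded generic_def, THEN conjunct2, rule_format,
          of "part B a" "part B b" "{x}" "\<lambda>_. col B a b"] ab ne x c(2) by simp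
    then obtain y where y: "y \<in> part_set G (part B b)" "col G y x = col B a b" by auto
    have "col G x y = col G y x"
      using G x y(1) ne by (auto simp: admissible_def is_lgraph_def part_set_def)
    then have "embedding (\<lambda>v. if v = a then x else y) B G"
      using 3 x y ne c(1) by (auto simp: embedding_def part_set_def inj_on_def)
    then show ?thesis by (auto simp: embeds_def)
  qed
  then show False using G B by (auto simp: admissible_def omits_def)
qed

section \<open>Necessity of the conditions\<close>

text \<open>Suppose an edge of colour \<open>c\<close> between parts \<open>k\<close>,
  \<open>l\<close> forms no forbidden triangle with the prescribed colours to \<open>i\<close> or to
  \<open>j\<close>. Then it extends by a vertex in part \<open>i\<close> and by one in part
  \<open>j\<close>, both extensions omitting \<F>, and any colour that \<open>G\<close> gives to the
  edge between these two completes a forbidden triangle with one end of the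
  \<open>kl\<close>-edge.\<close>

lemma realizes_imp_omission_condition:
  fixes G :: "('v, 'c) lgraph"
  assumes G: "adm G" "realizes 4 C \<F> G" and small: "no_small_members \<F>"
  shows "omission_condition C \<F>"
  unfolding omission_condition_iff
proof (intro allI impI ballI, elim conjE, rule ccontr)
  fix i j k l cik cil cjk cjl c
  assume ind: "distinct_indices i j k l"
    and cols: "cik \<in> C i k" "cil \<in> C i l" "cjk \<in> C j k" "cjl \<in> C j l"
    and forb: "\<forall>c\<in>C i j. forbtri i j k c cik cjk \<or> forbtri i j l c cil cjl"
    and c: "c \<in> C k l" and not_forb: "\<not> (forbtri k l i c cik cil \<or> forbtri k l j c cjk cjl)"
  have ne: "i \<noteq> j" "i \<noteq> k" "i \<noteq> l" "j \<noteq> k" "j \<noteq> l" "k \<noteq> l"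
    using ind by (auto simp: distinct_indices_def)
  note bound = distinct_indices_bound[OF ind]
  \<comment> \<open>The part indices themselves serve as vertices. The final \<open>c\<close> is
    meant for the pair \<open>k\<close>, \<open>l\<close>; it also falls on \<open>i\<close>,
    \<open>j\<close>, an edge that neither of the two induced graphs below contains.\<close>
  define \<kappa> where "\<kappa> p q =
    (if {p, q} = {i, k} then cik else if {p, q} = {i, l} then cil else
     if {p, q} = {j, k} then cjk else if {p, q} = {j, l} then cjl else c)" for p q
  let ?R = "\<lparr>verts = {i, j, k, l}, part = id, col = \<kappa>\<rparr>"
  have \<kappa>: "\<kappa> i k = cik" "\<kappa> k i = cik" "\<kappa> i l = cil" "\<kappa> l i = cil" "\<kappa> j k = cjk" "\<kappa> k j = cjk"
      "\<kappa> j l = cjl" "\<kappa> l j = cjl" "\<kappa> k l = c" "\<kappa> l k = c"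
    using ne by (auto simp: \<kappa>_def doubleton_eq_iff)
  have C: "C k i = C i k" "C l i = C i l" "C k j = C j k" "C l j = C j l" "C l k = C k l"
    using bound ne by - (rule C_commute; simp)+
  have "is_lgraph 4 C (induced ?R {i, k, l})" "is_lgraph 4 C (induced ?R {j, k, l})"
    using bound cols c by (auto simp: is_lgraph_def \<kappa> C)
  moreover have "omits \<F> (induced ?R {i, k, l})"
    by (rule omits_three_parts[OF small, of k l i]) (use ne not_forb in \<open>auto simp: \<kappa>\<close>)
  moreover have "omits \<F> (induced ?R {j, k, l})"
    by (rule omits_three_parts[OF small, of k l j]) (use ne not_forb in \<open>auto simp: \<kappa>\<close>)
  moreover have "verts ?R - {j} = {i, k, l}" "verts ?R - {i} = {j, k, l}" using ne by auto
  ultimately obtain h where h: "embedding h (induced ?R {i, k, l}) G" "embedding h (induced ?R {j, k, l}) G"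
    using realizes_two_points[OF G(2), of ?R i j] ne by (auto simp: admissible_def)
  have v: "h i \<in> verts G" "part G (h i) = i" "h j \<in> verts G" "part G (h j) = j"
      "h k \<in> verts G" "part G (h k) = k" "h l \<in> verts G" "part G (h l) = l"
    using h by (auto simp: embedding_def)
  have e: "col G (h i) (h k) = cik" "col G (h i) (h l) = cil"
      "col G (h j) (h k) = cjk" "col G (h j) (h l) = cjl"
    using h ne by (auto simp: embedding_def \<kappa>)
  have "col G (h i) (h j) \<in> C i j"
    using G(1) v ne unfolding admissible_def is_lgraph_def by metis
  moreover have "\<not> forbtri i j k (col G (h i) (h j)) cik cjk"
    using admissible_no_forbidden_triangle[OF G(1), of "h i" "h j" "h k" i j k] v ne e by simp
  moreover have "\<not> forbtri i j l (col G (h i) (h j)) cil cjl"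
    using admissible_no_forbidden_triangle[OF G(1), of "h i" "h j" "h l" i j l] v ne e by simp
  ultimately show False using forb by blast
qed

text \<open>The difficulty is to colour the edges between vertices that come from different members
  of the cover set without creating a forbidden triangle; this is where the assumption that no
  omission set in \<F> is based on \<open>\<A>\<close> enters. Whatever colour \<open>c\<close> then
  joins the two new points, the member chosen for \<open>c\<close> is completed inside
  \<open>G\<close>.\<close>

lemma realizes_imp_cover_condition:
  fixes G :: "('v, 'c) lgraph"
  assumes G: "adm G" "realizes 4 C \<F> G" and small: "no_small_members \<F>"
    and pne: "pairwise_non_embeddable \<F>"
  shows "cover_condition C \<F>"
  unfolding cover_condition_def
proof (intro allI impI, elim conjE, rule ccontr)
  fix i j k l \<A>
  assume \<A>: "\<A> \<subseteq> \<F>" and ind: "distinct_indices i j k l" and cover: "cover_set 4 C i j \<A>"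
    and contra: "\<not> (\<exists>\<B>\<subseteq>\<F>. \<exists>cik cil cjk cjl.
      omission_set 4 C i j k l cik cil cjk cjl \<B> \<and> based_on i j k l cik cil cjk cjl \<A>)"
  have ne: "i \<noteq> j" "i \<noteq> k" "i \<noteq> l" "j \<noteq> k" "j \<noteq> l" "k \<noteq> l"
    using ind by (auto simp: distinct_indices_def)
  note bound = distinct_indices_bound[OF ind]
  have C: "C j i = C i j" "C k i = C i k" "C l i = C i l" "C k j = C j k" "C l j = C j l" "C l k = C k l"
    using bound ne by - (rule C_commute; simp)+
  obtain M where M: "\<And>c. c \<in> C i j \<Longrightarrow> M c \<in> \<A>" "\<And>c. c \<in> C i j \<Longrightarrow> edge_coloured (M c) i j c"
    using cover unfolding cover_set_def by metis
  have MF: "M c \<in> \<F>" if "c \<in> C i j" for c using M(1) that \<A> by blast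
  \<comment> \<open>\<open>M c\<close> has the vertex \<open>v c p\<close> in part \<open>p\<close> if \<open>has c p\<close>; \<open>\<kappa> c p q\<close> is then the colour of its \<open>E\<^sub>p\<^sub>q\<close>-edge.\<close>
  define has where "has c p \<longleftrightarrow> part_set (M c) p \<noteq> {}" for c p
  define v where "v c p = (SOME w. w \<in> part_set (M c) p)" for c p
  define \<kappa> where "\<kappa> c p q = col (M c) (v c p) (v c q)" for c p q
  have v: "v c p \<in> verts (M c)" "part (M c) (v c p) = p" if "has c p" for c p
    using that some_in_eq[of "part_set (M c) p"] unfolding v_def has_def by (auto simp: part_set_def)
  have v_eq: "v c (part (M c) w) = w" "has c (part (M c) w)" if "c \<in> C i j" "w \<in> verts (M c)" for c w
  proof -
    show *: "has c (part (M c) w)" using that(2) by (auto simp: has_def part_set_def)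
    show "v c (part (M c) w) = w"
      using v[OF *] that monic_inj_part[OF monics[OF MF[OF that(1)]]] by (auto simp: inj_on_def)
  qed
  have hasij: "has c i" "has c j" and \<kappa>ij: "\<kappa> c i j = c" if c: "c \<in> C i j" for c
  proof -
    obtain x y where xy: "x \<in> part_set (M c) i" "y \<in> part_set (M c) j" "col (M c) x y = c"
      using M(2)[OF c] by (auto simp: edge_coloured_def)
    then show "has c i" "has c j" by (auto simp: has_def)
    have "v c i = x" "v c j = y" using v_eq(1)[OF c] xy by (auto simp: part_set_def)
    then show "\<kappa> c i j = c" using xy by (simp add: \<kappa>_def)
  qed
  have \<kappa>_sym: "\<kappa> c p q = \<kappa> c q p" and \<kappa>_in: "\<kappa> c p q \<in> C p q" and
    \<kappa>_edge: "edge_coloured (M c) p q (\<kappa> c p q)"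
    if "c \<in> C i j" "has c p" "has c q" "p \<noteq> q" for c p q
    using v[OF that(2)] v[OF that(3)] that(4)
      lgraph_col_commute[OF lgraphs[OF MF[OF that(1)]], of "v c p" "v c q"]
      lgraph_col_in[OF lgraphs[OF MF[OF that(1)]], of "v c p" "v c q"]
    by (auto simp: \<kappa>_def edge_coloured_def part_set_def)

  \<comment> \<open>The colour \<open>e\<close> can join the vertices of \<open>M c\<close> in part \<open>k\<close> and of \<open>M c'\<close> in part \<open>l\<close>.  If no colour
    could, \<open>\<F>\<close> would contain an omission set for parts \<open>k\<close>, \<open>l\<close>, and the omission condition would turn
    it into one for \<open>i\<close>, \<open>j\<close> based on \<open>\<A>\<close>.\<close>
  define ok where "ok c c' e \<longleftrightarrow> e \<in> C k l \<and> (c = c' \<longrightarrow> e = \<kappa> c k l) \<and>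
      \<not> forbtri k l i e (\<kappa> c k i) (\<kappa> c' l i) \<and> \<not> forbtri k l j e (\<kappa> c k j) (\<kappa> c' l j)" for c c' e
  have "\<exists>e. ok c c' e" if cc': "c \<in> C i j" "c' \<in> C i j" and hask: "has c k" and hasl: "has c' l" for c c'
  proof (cases "c = c'")
    case True
    \<comment> \<open>The colour is forced here, since a copy of \<open>M c\<close> is to arise. A
      forbidden triangle among these vertices would embed in \<open>M c\<close> and so equal it,
      although \<open>M c\<close> meets both \<open>i\<close> and \<open>j\<close> and the triangle
      only one of them.\<close>
    have "\<not> forbtri k l p (\<kappa> c k l) (\<kappa> c k p) (\<kappa> c l p)" if p: "p \<in> {i, j}" for p
    proof
      assume "forbtri k l p (\<kappa> c k l) (\<kappa> c k p) (\<kappa> c l p)"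
      then obtain B where B: "B \<in> \<F>" "triangle k l p B" "edge_coloured B k l (\<kappa> c k l)"
        "edge_coloured B k p (\<kappa> c k p)" "edge_coloured B l p (\<kappa> c l p)"
        by (auto simp: forbidden_triangle_def)
      have hp: "has c p" using p hasij[OF cc'(1)] by auto
      have "embeds B (M c)"
        by (rule triangle_embeds[OF lgraphs[OF B(1)] B(2) B(3-5)[unfolded \<kappa>_def] lgraphs[OF MF[OF cc'(1)]]])
          (use v hask hasl hp True ne p in auto)
      then have "B = M c"
        using pne B(1) MF[OF cc'(1)] by (auto simp: pairwise_non_embeddable_def)
      then have "part_set B i \<noteq> {}" "part_set B j \<noteq> {}" using hasij[OF cc'(1)] by (auto simp: has_def)
      then show False using B(2) p ne unfolding triangle_def by blast
    qed
    then show ?thesis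
      using \<kappa>_in[OF cc'(1) hask _ ne(6)] hasl True by (intro exI[of _ "\<kappa> c k l"]) (auto simp: ok_def)
  next
    case False
    have based: "based_on i j k l (\<kappa> c i k) (\<kappa> c' i l) (\<kappa> c j k) (\<kappa> c' j l) \<A>"
      unfolding based_on_def
    proof (rule bexI[OF _ M(1)[OF cc'(1)]], rule bexI[OF _ M(1)[OF cc'(2)]])
      show "part_set (M c) i \<noteq> {} \<and> part_set (M c) j \<noteq> {} \<and> part_set (M c) k \<noteq> {} \<and>
        edge_coloured (M c) i k (\<kappa> c i k) \<and> edge_coloured (M c) j k (\<kappa> c j k) \<and>
        part_set (M c') i \<noteq> {} \<and> part_set (M c') j \<noteq> {} \<and> part_set (M c') l \<noteq> {} \<and>
        edge_coloured (M c') i l (\<kappa> c' i l) \<and> edge_coloured (M c') j l (\<kappa> c' j l)"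
        using cc' hask hasl hasij[OF cc'(1)] hasij[OF cc'(2)] ne
        by (intro conjI \<kappa>_edge) (auto simp flip: has_def)
    qed
    have colours: "\<kappa> c i k \<in> C i k" "\<kappa> c' i l \<in> C i l" "\<kappa> c j k \<in> C j k" "\<kappa> c' j l \<in> C j l"
      using cc' hask hasl hasij[OF cc'(1)] hasij[OF cc'(2)] ne by (auto intro: \<kappa>_in)
    have sym: "\<kappa> c i k = \<kappa> c k i" "\<kappa> c' i l = \<kappa> c' l i" "\<kappa> c j k = \<kappa> c k j" "\<kappa> c' j l = \<kappa> c' l j"
      using cc' hask hasl hasij[OF cc'(1)] hasij[OF cc'(2)] ne by (auto intro: \<kappa>_sym)
    have "\<exists>e\<in>C k l. \<not> forbtri k l i e (\<kappa> c i k) (\<kappa> c' i l) \<and> \<not> forbtri k l j e (\<kappa> c j k) (\<kappa> c' j l)"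
    proof (rule ccontr)
      assume "\<not> ?thesis"
      then have "forbtri i j k d (\<kappa> c i k) (\<kappa> c j k) \<or> forbtri i j l d (\<kappa> c' i l) (\<kappa> c' j l)"
        if "d \<in> C i j" for d
        using omission_conditionD[OF realizes_imp_omission_condition[OF G small] distinct_indices_perm[OF ind],
            of "\<kappa> c i k" "\<kappa> c j k" "\<kappa> c' i l" "\<kappa> c' j l" d] that colours by (auto simp: C)
      then have "\<exists>\<B>\<subseteq>\<F>. omission_set 4 C i j k l (\<kappa> c i k) (\<kappa> c' i l) (\<kappa> c j k) (\<kappa> c' j l) \<B>"
        unfolding omission_set_iff using colours by blast
      then show False using contra based by blast
    qed
    then show ?thesis using False by (auto simp: ok_def sym)
  qed
  then obtain e where e: "\<And>c c'. \<lbrakk>c \<in> C i j; c' \<in> C i j; has c k; has c' l\<rbrakk> \<Longrightarrow> ok c c' (e c c')"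
    by metis
  have e_eq: "e c c = \<kappa> c k l" if "c \<in> C i j" "has c k" "has c l" for c
    using e[of c c] that by (simp add: ok_def)

  \<comment> \<open>Only a tag: an edge from \<open>(i, d)\<close> or \<open>(j, d)\<close> to
    \<open>(k, c)\<close> or \<open>(l, c)\<close> takes its colour from \<open>M c\<close>, so any
    element of \<open>C i j\<close> serves.\<close>
  obtain d where d: "d \<in> C i j" using C_nonempty bound ne(1) by blast
  \<comment> \<open>Vertices are pairs of a part and a colour: \<open>(i, d)\<close> and \<open>(j, d)\<close> are the two points to be
    amalgamated, while \<open>(k, c)\<close> and \<open>(l, c)\<close> copy the remaining vertices of \<open>M c\<close>.\<close>
  define \<chi> where "\<chi> x y = (case (x, y) of ((p, c), (q, c')) \<Rightarrow>
      if p \<in> {i, j} then \<kappa> c' p q else if q \<in> {i, j} then \<kappa> c p q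
      else if p = k then e c c' else e c' c)" for x y
  let ?W = "{(p, c). p \<in> {k, l} \<and> c \<in> C i j \<and> has c p}"
  let ?R = "\<lparr>verts = insert (i, d) (insert (j, d) ?W), part = fst, col = \<chi>\<rparr>"
  \<comment> \<open>Each half meets just the parts \<open>k\<close>, \<open>l\<close>,
    \<open>p\<close>, so only forbidden \<open>klp\<close>-triangles matter, and the choice of
    \<open>e\<close> by \<open>ok\<close> excludes them even when their vertices come from different
    members.\<close>
  have adm: "adm (induced ?R (insert (p, d) ?W))" if p: "p \<in> {i, j}" for p
  proof -
    have pk: "p \<noteq> k" "p \<noteq> l" "p < 4" using p ne bound by auto
    have has: "has c p" if "c \<in> C i j" for c using hasij[OF that] p by auto
    have Cp: "C k p = C p k" "C l p = C p l" using p C by auto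
    have "is_lgraph 4 C (induced ?R (insert (p, d) ?W))"
      unfolding is_lgraph_def induced_simps
    proof (intro conjI ballI impI)
      show "part ?R x < 4" if "x \<in> insert (p, d) ?W" for x using that pk bound by auto
      fix x y assume xy: "x \<in> insert (p, d) ?W" "y \<in> insert (p, d) ?W" "part ?R x \<noteq> part ?R y"
      obtain r c s c' where x: "x = (r, c)" and y: "y = (s, c')" by (metis surj_pair)
      have c: "c \<in> C i j" "c' \<in> C i j" "has c r" "has c' s" "r \<noteq> s"
        using xy d has unfolding x y by auto
      have rs: "r \<in> {p, k, l}" "s \<in> {p, k, l}" using xy unfolding x y by auto
      have kl: "k \<notin> {i, j}" "l \<notin> {i, j}" using ne by auto
      have "\<chi> x y = \<chi> y x \<and> \<chi> x y \<in> C r s"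
      proof (cases "r = p")
        case True
        then have "s \<notin> {i, j}" using rs kl c(5) by auto
        then have "\<chi> x y = \<kappa> c' p s" "\<chi> y x = \<kappa> c' s p" using p True by (auto simp: \<chi>_def x y)
        then show ?thesis using \<kappa>_sym[OF c(2) has c(4)] \<kappa>_in[OF c(2) has c(4)] c True by auto
      next
        case r: False
        then have rk: "r \<in> {k, l}" "r \<notin> {i, j}" using rs kl by auto
        show ?thesis
        proof (cases "s = p")
          case True
          then have "\<chi> x y = \<kappa> c r p" "\<chi> y x = \<kappa> c p r" using p rk by (auto simp: \<chi>_def x y)
          then show ?thesis using \<kappa>_sym[OF c(1) c(3) has] \<kappa>_in[OF c(1) c(3) has] c True by auto
        next
          case False
          then have "r = k \<and> s = l \<or> r = l \<and> s = k" using rk rs c(5) by auto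
          then show ?thesis
            using e[of c c'] e[of c' c] c ne kl by (auto simp: \<chi>_def x y ok_def C)
        qed
      qed
      then show "col ?R x y \<in> C (part ?R x) (part ?R y)" "col ?R x y = col ?R y x"
        by (auto simp: x y)
    qed
    moreover have "omits \<F> (induced ?R (insert (p, d) ?W))"
    proof (rule omits_three_parts[OF small, of k l p])
      show "part (induced ?R (insert (p, d) ?W)) x \<in> {k, l, p}"
        if "x \<in> verts (induced ?R (insert (p, d) ?W))" for x using that by auto
      fix x y z
      assume xyz: "x \<in> verts (induced ?R (insert (p, d) ?W))" "y \<in> verts (induced ?R (insert (p, d) ?W))"
        "z \<in> verts (induced ?R (insert (p, d) ?W))" "part (induced ?R (insert (p, d) ?W)) x = k"
        "part (induced ?R (insert (p, d) ?W)) y = l" "part (induced ?R (insert (p, d) ?W)) z = p"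
      then obtain c c' where x: "x = (k, c)" "c \<in> C i j" "has c k" and y: "y = (l, c')" "c' \<in> C i j" "has c' l"
        and z: "z = (p, d)" using ne pk by auto
      have "ok c c' (e c c')" using e x y by blast
      moreover have "\<chi> x y = e c c'" "\<chi> x z = \<kappa> c k p" "\<chi> y z = \<kappa> c' l p"
        using ne p by (auto simp: \<chi>_def x y z)
      ultimately show "\<not> forbtri k l p (col (induced ?R (insert (p, d) ?W)) x y)
          (col (induced ?R (insert (p, d) ?W)) x z) (col (induced ?R (insert (p, d) ?W)) y z)"
        using p by (auto simp: ok_def)
    qed (use ne pk in auto)
    ultimately show ?thesis by (simp add: admissible_def)
  qed
  have "finite (C i j)" using C_finite bound ne by blast
  then have "finite ?W" by (rule_tac finite_subset[of _ "{k, l} \<times> C i j"]) auto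
  moreover have "verts ?R - {(i, d)} = insert (j, d) ?W" "verts ?R - {(j, d)} = insert (i, d) ?W"
    using ne by auto
  ultimately obtain h where h: "embedding h (induced ?R (insert (j, d) ?W)) G"
      "embedding h (induced ?R (insert (i, d) ?W)) G"
    using realizes_two_points[OF G(2), of ?R "(i, d)" "(j, d)"] adm ne by auto
  have h_in: "h x \<in> verts G \<and> part G (h x) = fst x" if "x \<in> verts ?R" for x
    using h that by (auto simp: embedding_def)
  have h_col: "col G (h x) (h y) = \<chi> x y"
    if "{x, y} \<subseteq> insert (i, d) ?W \<or> {x, y} \<subseteq> insert (j, d) ?W" "fst x \<noteq> fst y" for x y
    using h that unfolding embedding_def by auto
  \<comment> \<open>\<open>G\<close> must give this edge some colour \<open>c\<close>, and the
    copies tagged \<open>c\<close> were laid out for exactly this case.\<close>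
  define c where "c = col G (h (i, d)) (h (j, d))"
  have c: "c \<in> C i j" "col G (h (j, d)) (h (i, d)) = c"
  proof -
    have "h (i, d) \<in> verts G" "part G (h (i, d)) = i" "h (j, d) \<in> verts G" "part G (h (j, d)) = j"
      using h_in[of "(i, d)"] h_in[of "(j, d)"] by auto
    then show "c \<in> C i j" "col G (h (j, d)) (h (i, d)) = c"
      using G(1) ne unfolding c_def admissible_def is_lgraph_def by metis+
  qed
  \<comment> \<open>The vertex standing for the part \<open>p\<close> vertex of \<open>M c\<close>,
    when there is one.\<close>
  define t where "t p = (p, if p \<in> {i, j} then d else c)" for p
  have t: "t p \<in> verts ?R" "p \<in> {i, j, k, l}" "p \<notin> {i, j} \<Longrightarrow> t p \<in> ?W" if "has c p" for p
  proof -
    have "p < 4" using v[OF that] lgraphs[OF MF[OF c(1)]] by (auto simp: is_lgraph_def)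
    then show p: "p \<in> {i, j, k, l}" using distinct_indices_cases[OF ind] by blast
    then show "t p \<in> verts ?R" "p \<notin> {i, j} \<Longrightarrow> t p \<in> ?W" using that c by (auto simp: t_def)
  qed
  have t_col: "col G (h (t p)) (h (t q)) = \<kappa> c p q" if pq: "has c p" "has c q" "p \<noteq> q" for p q
  proof (cases "p \<in> {i, j} \<and> q \<in> {i, j}")
    case True
    then have "p = i \<and> q = j \<or> p = j \<and> q = i" using pq by auto
    then show ?thesis
      using \<kappa>ij[OF c(1)] \<kappa>_sym[OF c(1) hasij[OF c(1)] ne(1)] c(2) by (auto simp: t_def c_def)
  next
    case False
    have "fst (t p) \<noteq> fst (t q)" using pq by (simp add: t_def)
    \<comment> \<open>Only the pair \<open>i\<close>, \<open>j\<close> is split between the two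
      halves; every other pair lies in one of them, where \<open>h\<close> is an embedding.\<close>
    moreover have "{t p, t q} \<subseteq> insert (i, d) ?W \<or> {t p, t q} \<subseteq> insert (j, d) ?W"
    proof (cases "p \<in> {i, j}")
      case True
      then have "q \<notin> {i, j}" using False by blast
      then have "t q \<in> ?W" by (rule t(3)[OF pq(2)])
      moreover have "t p = (i, d) \<or> t p = (j, d)" using True by (auto simp: t_def)
      ultimately show ?thesis by auto
    next
      case p: False
      then have "t p \<in> ?W" by (rule t(3)[OF pq(1)])
      moreover have "t q \<in> ?W \<or> t q = (i, d) \<or> t q = (j, d)"
        using t(1)[OF pq(2)] by auto
      ultimately show ?thesis by auto
    qed
    ultimately have "col G (h (t p)) (h (t q)) = \<chi> (t p) (t q)" using h_col by blast
    also have "\<dots> = \<kappa> c p q"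
    proof (cases "p \<in> {i, j} \<or> q \<in> {i, j}")
      case True
      then show ?thesis using False by (auto simp: \<chi>_def t_def)
    next
      case False
      then have "p = k \<and> q = l \<or> p = l \<and> q = k" using t(2)[OF pq(1)] t(2)[OF pq(2)] pq(3) by auto
      then show ?thesis
        using False pq e_eq[OF c(1)] \<kappa>_sym[OF c(1) pq] ne by (auto simp: \<chi>_def t_def)
    qed
    finally show ?thesis .
  qed
  have "embedding (h \<circ> t \<circ> part (M c)) (M c) G"
  proof -
    have 1: "h (t (part (M c) w)) \<in> verts G" "part G (h (t (part (M c) w))) = part (M c) w"
      if "w \<in> verts (M c)" for w
      using h_in[OF t(1)[OF v_eq(2)[OF c(1) that]]] by (auto simp: t_def)
    have 2: "col G (h (t (part (M c) w))) (h (t (part (M c) w'))) = col (M c) w w'"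
      if "w \<in> verts (M c)" "w' \<in> verts (M c)" "part (M c) w \<noteq> part (M c) w'" for w w'
      using t_col[OF v_eq(2)[OF c(1) that(1)] v_eq(2)[OF c(1) that(2)] that(3)]
        v_eq(1)[OF c(1) that(1)] v_eq(1)[OF c(1) that(2)] by (simp add: \<kappa>_def)
    have "inj_on (h \<circ> t \<circ> part (M c)) (verts (M c))"
      using 1(2) monic_inj_part[OF monics[OF MF[OF c(1)]]] unfolding inj_on_def comp_def by metis
    then show ?thesis using 1 2 by (auto simp: embedding_def)
  qed
  then show False using G(1) MF[OF c(1)] by (auto simp: admissible_def omits_def embeds_def)
qed

section \<open>Sufficiency of the conditions\<close>

text \<open>Amalgamation of \<open>y\<close> and the new vertex \<open>z\<close> over
  \<open>S\<close>, phrased so that it can be iterated: \<open>G\<close> stays fixed while one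
  further edge at \<open>z\<close> is coloured.\<close>

lemma one_more_colour:
  assumes om: "omission_condition C \<F>" and cov: "cover_condition C \<F>"
    and G: "adm G" and S: "S \<subseteq> verts G" and y: "y \<in> verts G" "y \<notin> S"
    and z: "z \<notin> verts G" and i: "i < 4"
    and X: "adm (add_vertex (induced G S) z i g)"
  shows "\<exists>c. adm (add_vertex (induced G (insert y S)) z i (g(y := c)))"
proof (rule ccontr)
  assume contra: "\<nexists>c. adm (add_vertex (induced G (insert y S)) z i (g(y := c)))"
  let ?Y = "add_vertex (induced G S) z i g"
  let ?X = "\<lambda>c. add_vertex (induced G (insert y S)) z i (g(y := c))"
  let ?j = "part G y"
  have yz: "y \<noteq> z" and zS: "z \<notin> S" using y z S by auto
  have j: "?j < 4" using G y by (auto simp: admissible_def is_lgraph_def)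
  have GL: "is_lgraph 4 C G" and XL: "is_lgraph 4 C ?Y" using G X by (auto simp: admissible_def)
  have g_in: "g s \<in> C i (part G s)" if "s \<in> S" "part G s \<noteq> i" for s
  proof -
    have "s \<noteq> z" using that zS by blast
    then show ?thesis using lgraph_col_in[OF XL, of z s] that by auto
  qed
  have X_lgraph: "is_lgraph 4 C (?X c)" if c: "i \<noteq> ?j \<Longrightarrow> c \<in> C i ?j" for c
    unfolding is_lgraph_def
  proof (intro conjI ballI impI)
    show "part (?X c) v < 4" if "v \<in> verts (?X c)" for v
      using that i GL S y by (auto simp: is_lgraph_def)
    fix v w assume vw: "v \<in> verts (?X c)" "w \<in> verts (?X c)" "part (?X c) v \<noteq> part (?X c) w"
    have inG: "u \<in> verts G" if "u \<in> insert y S" for u using that S y by auto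
    have gc: "(g(y := c)) u \<in> C i (part G u)" "C (part G u) i = C i (part G u)"
      if "u \<in> insert y S" "part G u \<noteq> i" for u
    proof -
      show "(g(y := c)) u \<in> C i (part G u)" using g_in[of u] c that by (cases "u = y") auto
      show "C (part G u) i = C i (part G u)"
        using that i inG[OF that(1)] GL by (intro C_commute) (auto simp: is_lgraph_def)
    qed
    consider "v = z" "w \<noteq> z" "w \<in> insert y S" | "v \<noteq> z" "w = z" "v \<in> insert y S"
      | "v \<noteq> z" "w \<noteq> z" "v \<in> insert y S" "w \<in> insert y S"
      using vw by auto
    then have "col (?X c) v w \<in> C (part (?X c) v) (part (?X c) w) \<and> col (?X c) v w = col (?X c) w v"
    proof cases
      case 1
      then show ?thesis using gc(1)[of w] vw(3) by simp
    next
      case 2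
      then show ?thesis using gc[of v] vw(3) by simp
    next
      case 3
      then show ?thesis
        using vw(3) lgraph_col_in[OF GL inG inG, of v w] lgraph_col_commute[OF GL inG inG, of v w] by simp
    qed
    then show "col (?X c) v w \<in> C (part (?X c) v) (part (?X c) w)" "col (?X c) v w = col (?X c) w v"
      by blast+
  qed
  \<comment> \<open>A forbidden copy avoiding \<open>y\<close> would lie in \<open>?Y\<close>, one
    avoiding \<open>z\<close> in \<open>G\<close>. A monic containing both needs them in different
    parts, which also rules out that \<open>y\<close> has part \<open>i\<close>, the case in which
    \<open>c\<close> is unrestricted.\<close>
  have bad: "i \<noteq> ?j \<and> (\<exists>B\<in>\<F>. \<exists>h. embedding h B (?X c) \<and> y \<in> h ` verts B \<and> z \<in> h ` verts B)"
    if c: "i \<noteq> ?j \<Longrightarrow> c \<in> C i ?j" for c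
  proof -
    obtain B h where B: "B \<in> \<F>" and h: "embedding h B (?X c)"
      using contra X_lgraph[OF c] by (auto simp: admissible_def omits_def embeds_def)
    have "y \<in> h ` verts B"
    proof (rule ccontr)
      assume "y \<notin> h ` verts B"
      moreover from this have "h ` verts B \<subseteq> insert z S"
        using h by (auto simp: embedding_def)
      ultimately have "embedding h B ?Y"
        by (intro embedding_retarget[OF h]) auto
      then show False using X B by (auto simp: admissible_def omits_def embeds_def)
    qed
    moreover have "z \<in> h ` verts B"
    proof (rule ccontr)
      assume "z \<notin> h ` verts B"
      moreover from this have "h ` verts B \<subseteq> verts G"
        using h S y by (auto simp: embedding_def)
      ultimately have "embedding h B G"
        by (intro embedding_retarget[OF h]) auto
      then show False using G B by (auto simp: admissible_def omits_def embeds_def)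
    qed
    moreover from calculation obtain a b where "a \<in> verts B" "b \<in> verts B" "h a = y" "h b = z" by auto
    then have "part B a \<noteq> part B b" "part B a = ?j" "part B b = i"
      using h yz monic_inj_part[OF monics[OF B]] by (auto simp: embedding_def inj_on_def)
    ultimately show ?thesis using B h by auto
  qed
  then have ne: "i \<noteq> ?j" by metis
  have "\<exists>B h. B \<in> \<F> \<and> embedding h B (?X c) \<and> y \<in> h ` verts B \<and> z \<in> h ` verts B"
    if "c \<in> C i ?j" for c using bad that by blast
  then obtain M h where M: "\<And>c. c \<in> C i ?j \<Longrightarrow> M c \<in> \<F>" "\<And>c. c \<in> C i ?j \<Longrightarrow> embedding (h c) (M c) (?X c)"
    and h: "\<And>c. c \<in> C i ?j \<Longrightarrow> y \<in> h c ` verts (M c)" "\<And>c. c \<in> C i ?j \<Longrightarrow> z \<in> h c ` verts (M c)"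
    by metis
  have edge: "edge_coloured (M c) i ?j c" if c: "c \<in> C i ?j" for c
  proof -
    obtain a b where ab: "a \<in> verts (M c)" "b \<in> verts (M c)" "h c a = y" "h c b = z"
      using h[OF c] by auto
    have "part (M c) a = ?j" "part (M c) b = i" using M(2)[OF c] ab yz by (auto simp: embedding_def)
    moreover from this have "col (M c) b a = c"
      using M(2)[OF c] ab yz ne unfolding embedding_def by (metis add_vertex_simps(3) fun_upd_same)
    ultimately show ?thesis using ab by (auto simp: edge_coloured_def part_set_def)
  qed
  \<comment> \<open>Turns colours of \<open>M c\<close> into colours at actual vertices: its vertex
    in a part \<open>p\<close> other than those of \<open>y\<close> and \<open>z\<close> is mapped
    neither to \<open>y\<close> nor to \<open>z\<close>, hence into \<open>S\<close>.\<close>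
  have link: "\<exists>u\<in>S. part G u = p \<and> g u = \<alpha> \<and> col G u y = \<beta>"
    if c: "c \<in> C i ?j" and p: "p \<noteq> i" "p \<noteq> ?j"
      and e: "edge_coloured (M c) i p \<alpha>" "edge_coloured (M c) ?j p \<beta>" for c p \<alpha> \<beta>
  proof -
    note emb = M(2)[OF c]
    have inj: "inj_on (part (M c)) (verts (M c))" using monic_inj_part monics M(1)[OF c] by blast
    obtain a b where ab: "a \<in> verts (M c)" "b \<in> verts (M c)" "h c a = y" "h c b = z"
      using h[OF c] by auto
    have ab_part: "part (M c) a = ?j" "part (M c) b = i" using emb ab yz by (auto simp: embedding_def)
    obtain w w' b' a' where w: "w \<in> part_set (M c) p" "w' \<in> part_set (M c) p" "b' \<in> part_set (M c) i"
        "a' \<in> part_set (M c) ?j" "col (M c) b' w = \<alpha>" "col (M c) a' w' = \<beta>"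
      using e by (auto simp: edge_coloured_def)
    then have "w' = w" "b' = b" "a' = a"
      using inj ab ab_part by (auto simp: part_set_def inj_on_def)
    then have w: "w \<in> verts (M c)" "part (M c) w = p" "col (M c) b w = \<alpha>" "col (M c) a w = \<beta>"
      using w by (auto simp: part_set_def)
    have u: "h c w \<in> insert z (insert y S)" "part (?X c) (h c w) = p"
      using emb w by (auto simp: embedding_def)
    then have u': "h c w \<noteq> z" "h c w \<noteq> y" "h c w \<in> S" "part G (h c w) = p"
      using p yz by (auto split: if_splits)
    have "col (?X c) z (h c w) = \<alpha>" "col (?X c) y (h c w) = \<beta>"
      using emb ab ab_part w p unfolding embedding_def by metis+
    then have "g (h c w) = \<alpha>" "col G y (h c w) = \<beta>" using u' yz by simp_all
    moreover have "col G (h c w) y = col G y (h c w)"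
      using lgraph_col_commute[OF GL, of "h c w" y] u' S y p by auto
    ultimately show ?thesis using u' by auto
  qed
  obtain k l where ind: "distinct_indices i ?j k l"
    using distinct_indices_exist[OF i j ne] by blast
  have kl: "k \<noteq> i" "k \<noteq> ?j" "l \<noteq> i" "l \<noteq> ?j" "k \<noteq> l" using ind by (auto simp: distinct_indices_def)
  have "cover_set 4 C i ?j (M ` C i ?j)"
    using edge M(1) monics by (auto simp: cover_set_def)
  then obtain \<B> cik cil cjk cjl where \<B>: "\<B> \<subseteq> \<F>" "omission_set 4 C i ?j k l cik cil cjk cjl \<B>"
    and based: "based_on i ?j k l cik cil cjk cjl (M ` C i ?j)"
    using cov[unfolded cover_condition_def, rule_format, of "M ` C i ?j" i ?j k l] ind M(1)
    by (auto simp: image_subset_iff)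
  obtain c c' where c: "c \<in> C i ?j" "edge_coloured (M c) i k cik" "edge_coloured (M c) ?j k cjk"
    and c': "c' \<in> C i ?j" "edge_coloured (M c') i l cil" "edge_coloured (M c') ?j l cjl"
    using based unfolding based_on_def by blast
  obtain u where u: "u \<in> S" "part G u = k" "g u = cik" "col G u y = cjk"
    using link[OF c(1) kl(1,2) c(2,3)] by blast
  obtain v where v: "v \<in> S" "part G v = l" "g v = cil" "col G v y = cjl"
    using link[OF c'(1) kl(3,4) c'(2,3)] by blast
  have uv: "u \<in> verts G" "v \<in> verts G" "u \<noteq> z" "v \<noteq> z" using u v S z by auto
  have "\<exists>\<B>\<subseteq>\<F>. omission_set 4 C i ?j k l cik cil cjk cjl \<B>" using \<B> by blast
  note om_set = this[unfolded omission_set_iff]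
  \<comment> \<open>Both \<open>uvz\<close> and \<open>uvy\<close> are triangles in admissible
    graphs, but the corresponding omission set forbids one of them for every colour of
    \<open>uv\<close>.\<close>
  have "col G u v \<in> C k l" using lgraph_col_in[OF GL uv(1,2)] u v kl by simp
  then have "forbtri k l i (col G u v) cik cil \<or> forbtri k l ?j (col G u v) cjk cjl"
    using omission_conditionD[OF om ind, of cik cil cjk cjl] om_set by blast
  moreover have "\<not> forbtri k l i (col G u v) cik cil"
    using admissible_no_forbidden_triangle[OF X, of u v z k l i] u v uv kl by simp
  moreover have "\<not> forbtri k l ?j (col G u v) cjk cjl"
    using admissible_no_forbidden_triangle[OF G, of u v y k l ?j] u v uv kl y by simp
  ultimately show False by blast
qed

text \<open>Iterates \<open>one_more_colour\<close> over the vertices outside \<open>S\<close>; the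
  colours already prescribed on \<open>S\<close> are kept, as the tasks of the limit construction
  demand.\<close>

lemma all_colours:
  assumes om: "omission_condition C \<F>" and cov: "cover_condition C \<F>"
    and G: "finite (verts G)" "adm G" and S: "S \<subseteq> verts G"
    and z: "z \<notin> verts G" and i: "i < 4"
    and X: "adm (add_vertex (induced G S) z i g)"
  shows "\<exists>g'. (\<forall>s\<in>S. g' s = g s) \<and> adm (add_vertex G z i g')"
proof -
  have "finite T \<Longrightarrow> T \<subseteq> verts G \<Longrightarrow>
      \<exists>g'. (\<forall>s\<in>S. g' s = g s) \<and> adm (add_vertex (induced G (S \<union> T)) z i g')" for T
  proof (induction T rule: finite_induct)
    case empty
    then show ?case using X by auto
  next
    case (insert t T)
    then obtain g' where g': "\<forall>s\<in>S. g' s = g s" "adm (add_vertex (induced G (S \<union> T)) z i g')"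
      by auto
    show ?case
    proof (cases "t \<in> S")
      case True
      then show ?thesis using g' by (metis Un_insert_right insert_absorb UnI1)
    next
      case False
      then obtain c where "adm (add_vertex (induced G (insert t (S \<union> T))) z i (g'(t := c)))"
        using one_more_colour[OF om cov G(2) _ _ _ z i g'(2), of t] insert S by auto
      moreover have "\<forall>s\<in>S. (g'(t := c)) s = g s" using g'(1) False by auto
      ultimately show ?thesis by (metis Un_insert_right)
    qed
  qed
  from this[OF G(1)] show ?thesis using S by (simp add: Un_absorb1)
qed

section \<open>Genericity and the construction of the limit\<close>

lemma realizes_imp_extension:
  fixes G :: "('v, 'c) lgraph"
  assumes G: "realizes 4 C \<F> G" and small: "no_small_members \<F>"
    and U: "finite U" "U \<subseteq> part_set G i" "i < 4" "j < 4"
    and f: "i \<noteq> j \<Longrightarrow> \<forall>u\<in>U. f u \<in> C i j"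
  shows "\<exists>x\<in>part_set G j. x \<notin> U \<and> (i \<noteq> j \<longrightarrow> (\<forall>u\<in>U. col G x u = f u))"
proof -
  \<comment> \<open>\<open>None\<close> is the vertex to be added to \<open>U\<close>. The graph
    meets at most two parts, so it omits \<F> automatically. With \<open>i = j\<close> there are no
    edges, and the content is that the new vertex lies outside \<open>U\<close>.\<close>
  let ?A = "\<lparr>verts = insert None (Some ` U), part = case_option j (\<lambda>_. i),
    col = \<lambda>x y. case x of None \<Rightarrow> f (the y) | Some u \<Rightarrow> f u\<rparr>"
  have "is_lgraph 4 C ?A"
    using U f C_commute[of i j] by (auto simp: is_lgraph_def)
  moreover have "omits \<F> ?A"
    by (rule omits_two_parts[OF small, of _ i j]) auto
  moreover have "embedding the (induced ?A (verts ?A - {None})) G"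
    using U by (auto simp: embedding_def part_set_def inj_on_def)
  ultimately obtain y where "embedding (the(None := y)) ?A G"
    using realizes_point[OF G, of ?A None the] U(1) by (auto simp: admissible_def)
  then have y: "y \<in> part_set G j" "\<forall>u\<in>U. u \<noteq> y" "i \<noteq> j \<longrightarrow> (\<forall>u\<in>U. col G y u = f u)"
    unfolding embedding_def by (auto simp: part_set_def inj_on_def)
  then show ?thesis by blast
qed

lemma realizes_imp_generic:
  assumes "countable (verts G)" "realizes 4 C \<F> G" "no_small_members \<F>"
  shows "generic 4 C G"
  unfolding generic_def
proof (intro conjI allI impI, goal_cases)
  case (1 i)
  show ?case using assms(1) by (rule countable_subset[rotated]) (auto simp: part_set_def)
next
  case (2 i)
  \<comment> \<open>If part \<open>i\<close> were finite, it could be taken as \<open>U\<close>, and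
    the new vertex would lie outside it.\<close>
  then show ?case using realizes_imp_extension[OF assms(2,3), of "part_set G i" i i] by auto
next
  case (3 i j U f)
  then show ?case using realizes_imp_extension[OF assms(2,3), of U i j f] by blast
qed

text \<open>A Fraisse limit built directly on the natural numbers: \<open>all_colours\<close>
  completes each partly prescribed new vertex to one joined to the whole stage without creating a
  copy of a member of \<F>.\<close>

lemma exists_realizing:
  assumes small: "no_small_members \<F>" and om: "omission_condition C \<F>" and cov: "cover_condition C \<F>"
  shows "\<exists>G :: (nat, 'c) lgraph. adm G \<and> realizes 4 C \<F> G"
proof -
  \<comment> \<open>A task \<open>(i, xs)\<close> asks for a vertex in part \<open>i\<close> joined to the earlier vertices listed in \<open>xs\<close> with the
    given colours.  Stage \<open>n\<close> adds the vertex \<open>n\<close>; each task recurs at arbitrarily late stages.\<close>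
  define K where "K = (\<Union>i<4. \<Union>j\<in>{..<4} - {i}. C i j)"
  have "finite K" unfolding K_def using C_finite by (intro finite_UN_I) auto
  define Tasks where "Tasks = {..<4 :: nat} \<times> lists ((UNIV :: nat set) \<times> K)"
  have "countable Tasks"
    unfolding Tasks_def using \<open>finite K\<close> by (intro countable_SIGMA countable_lists) (auto intro: countable_finite)
  \<comment> \<open>The first component of \<open>prod_decode n\<close> numbers the task; the second
    makes it recur.\<close>
  define task where "task n = from_nat_into Tasks (fst (prod_decode n))" for n
  define P where "P n G \<longleftrightarrow> verts G = {..<n} \<and> adm G" for n and G :: "(nat, 'c) lgraph"
  \<comment> \<open>Existing vertices keep their parts and colours for good. The task binds only if
    its vertices already exist and the prescribed one-point extension is admissible.\<close>
  define Q where "Q n G G' \<longleftrightarrow>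
      (\<forall>x<n. part G' x = part G x) \<and> (\<forall>x<n. \<forall>y<n. col G' x y = col G x y) \<and>
      (\<forall>i xs. task n = (i, xs) \<and> i < 4 \<and> fst ` set xs \<subseteq> {..<n} \<and>
         adm (add_vertex (induced G (fst ` set xs)) n i (the \<circ> map_of xs)) \<longrightarrow>
         part G' n = i \<and> (\<forall>s\<in>fst ` set xs. col G' n s = the (map_of xs s)))"
    for n and G G' :: "(nat, 'c) lgraph"
  have "\<exists>S. \<forall>n. P n (S n) \<and> Q n (S n) (S (Suc n))"
  proof (rule dependent_nat_choice)
    let ?E = "\<lparr>verts = {}, part = \<lambda>_. 0, col = undefined\<rparr> :: (nat, 'c) lgraph"
    have "omits \<F> ?E" using omits_two_parts[OF small, of ?E] by auto
    then show "\<exists>G. P 0 G" by (intro exI[of _ ?E]) (simp add: P_def admissible_def is_lgraph_def)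
  next
    fix G :: "(nat, 'c) lgraph" and n
    assume "P n G"
    then have V: "verts G = {..<n}" and G: "adm G" by (auto simp: P_def)
    have n: "n \<notin> verts G" "finite (verts G)" using V by auto
    have step: "\<exists>G'. P (Suc n) G' \<and> (\<forall>x<n. part G' x = part G x) \<and>
        (\<forall>x<n. \<forall>y<n. col G' x y = col G x y) \<and> part G' n = i \<and> (\<forall>s\<in>S. col G' n s = g s)"
      if S: "i < 4" "S \<subseteq> {..<n}" "adm (add_vertex (induced G S) n i g)" for i S g
    proof -
      obtain g' where g': "\<forall>s\<in>S. g' s = g s" "adm (add_vertex G n i g')"
        using all_colours[OF om cov n(2) G _ n(1) S(1,3)] S(2) V by auto
      then show ?thesis
        using V S(2) by (intro exI[of _ "add_vertex G n i g'"]) (auto simp: P_def lessThan_Suc)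
    qed
    show "\<exists>G'. P (Suc n) G' \<and> Q n G G'"
    proof (cases "case task n of (i, xs) \<Rightarrow> i < 4 \<and> fst ` set xs \<subseteq> {..<n} \<and>
         adm (add_vertex (induced G (fst ` set xs)) n i (the \<circ> map_of xs))")
      case True
      obtain i xs where t: "task n = (i, xs)" by fastforce
      with True obtain G' where "P (Suc n) G'" "\<forall>x<n. part G' x = part G x"
        "\<forall>x<n. \<forall>y<n. col G' x y = col G x y" "part G' n = i"
        "\<forall>s\<in>fst ` set xs. col G' n s = the (map_of xs s)"
        using step[of i "fst ` set xs" "the \<circ> map_of xs"] by auto
      then have "P (Suc n) G' \<and> Q n G G'" using t unfolding Q_def by simp
      then show ?thesis ..
    next
      case False
      \<comment> \<open>A vertex is added even without a binding task, so that stage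
        \<open>n\<close> always has vertex set \<open>{..<n}\<close>; it goes to part
        \<open>0\<close> with no prescribed edge.\<close>
      let ?Y = "add_vertex (induced G {}) n 0 undefined"
      have "omits \<F> ?Y" using omits_two_parts[OF small, of ?Y 0 0] by auto
      then have "adm ?Y" by (simp add: admissible_def is_lgraph_def)
      then obtain G' where "P (Suc n) G'" "\<forall>x<n. part G' x = part G x"
        "\<forall>x<n. \<forall>y<n. col G' x y = col G x y"
        using step[of 0 "{}" undefined] by auto
      moreover have "\<not> (i < 4 \<and> fst ` set xs \<subseteq> {..<n} \<and>
         adm (add_vertex (induced G (fst ` set xs)) n i (the \<circ> map_of xs)))"
        if "task n = (i, xs)" for i xs using False that by simp
      ultimately have "P (Suc n) G' \<and> Q n G G'" unfolding Q_def by blast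
      then show ?thesis ..
    qed
  qed
  then obtain S where S: "\<And>n. P n (S n)" "\<And>n. Q n (S n) (S (Suc n))" by blast
  \<comment> \<open>Vertex \<open>x\<close> is first present in stage \<open>Suc x\<close>, the edge
    \<open>xy\<close> in stage \<open>Suc (max x y)\<close>; by \<open>stable\<close> below, later
    stages agree.\<close>
  define G where "G = \<lparr>verts = UNIV, part = \<lambda>x. part (S (Suc x)) x,
    col = \<lambda>x y. col (S (Suc (max x y))) x y\<rparr>"
  have stable: "part (S m) x = part (S n) x \<and> (\<forall>y<n. col (S m) x y = col (S n) x y)"
    if "n \<le> m" "x < n" for n m x
    using that(1)
  proof (induction m rule: dec_induct)
    case (step m)
    then have "x < m" using that by simp
    then have "part (S (Suc m)) x = part (S m) x" "\<forall>y<m. col (S (Suc m)) x y = col (S m) x y"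
      using S(2)[of m] unfolding Q_def by blast+
    then show ?case using step by auto
  qed simp
  have part_G: "part G x = part (S n) x" if "x < n" for x n
    using stable[of "Suc x" n x] that by (auto simp: G_def)
  have col_G: "col G x y = col (S n) x y" if "x < n" "y < n" for x y n
    using stable[of "Suc (max x y)" n x] that by (auto simp: G_def)
  have verts_S: "verts (S n) = {..<n}" and adm_S: "adm (S n)" for n using S(1) by (auto simp: P_def)
  \<comment> \<open>Finite pieces of \<open>G\<close> live in stages. This carries the omission of
    \<F> from the stages to \<open>G\<close>, and later allows \<open>f\<close> to be read as a map
    into \<open>S n\<close>.\<close>
  have into_S: "embedding h B (S n)" if "embedding h B G" "h ` verts B \<subseteq> {..<n}"
    for h :: "'z \<Rightarrow> nat" and B :: "('z, 'c) lgraph" and n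
  proof (rule embedding_retarget[OF that(1)])
    have less: "x < n" if "x \<in> h ` verts B" for x using that \<open>h ` verts B \<subseteq> {..<n}\<close> by blast
    show "h ` verts B \<subseteq> verts (S n)" using that(2) by (simp only: verts_S)
    show "part (S n) x = part G x" if "x \<in> h ` verts B" for x
      using part_G[OF less[OF that]] by simp
    show "col (S n) x y = col G x y" if "x \<in> h ` verts B" "y \<in> h ` verts B" for x y
      using col_G[OF less[OF that(1)] less[OF that(2)]] by simp
  qed
  have adm_G: "adm G"
  proof -
    have "is_lgraph 4 C G"
      unfolding is_lgraph_def
    proof (intro conjI ballI impI)
      fix x y
      let ?n = "Suc (max x y)"
      have L: "is_lgraph 4 C (S ?n)" using adm_S by (simp add: admissible_def)
      have xy: "x < ?n" "y < ?n" by auto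
      have in_S: "x \<in> verts (S ?n)" "y \<in> verts (S ?n)" by (auto simp: verts_S)
      show "part G x < 4"
        using L in_S unfolding part_G[OF xy(1)] by (simp add: is_lgraph_def)
      assume "part G x \<noteq> part G y"
      then show "col G x y \<in> C (part G x) (part G y)" "col G x y = col G y x"
        using lgraph_col_in[OF L in_S] lgraph_col_commute[OF L in_S]
        unfolding part_G[OF xy(1)] part_G[OF xy(2)] col_G[OF xy] col_G[OF xy(2,1)] by auto
    qed
    moreover have "omits \<F> G"
      unfolding omits_def embeds_def
    proof (intro ballI notI, elim exE)
      fix B h assume B: "B \<in> \<F>" and h: "embedding h B G"
      have "finite (h ` verts B)" using monics[OF B] by (simp add: monic_def)
      then obtain n where "h ` verts B \<subseteq> {..<n}" by (metis finite_nat_iff_bounded)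
      then have "embeds B (S n)" using into_S[OF h] by (auto simp: embeds_def)
      then show False using adm_S[of n] B by (auto simp: admissible_def omits_def)
    qed
    ultimately show ?thesis by (simp add: admissible_def)
  qed
  moreover have "realizes 4 C \<F> G"
    unfolding realizes_def
  proof (intro allI impI, elim conjE)
    fix A :: "(nat, 'c) lgraph" and a f
    assume A: "finite (verts A)" "adm A" "a \<in> verts A"
      and f: "embedding f (induced A (verts A - {a})) G"
    have AL: "is_lgraph 4 C A" using A by (simp add: admissible_def)
    let ?i = "part A a"
    \<comment> \<open>Only the vertices in parts other than that of \<open>a\<close> have an edge to
      \<open>a\<close>; towards the rest it suffices that the new vertex is fresh.\<close>
    let ?D = "{b \<in> verts A. part A b \<noteq> ?i}"
    have D: "finite ?D" "?D \<subseteq> verts A - {a}" using A(1) by auto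
    have inj: "inj_on f (verts A - {a})" using f by (simp add: embedding_def)
    define k where "k = inv_into (verts A - {a}) f"
    have k: "k (f b) = b" if "b \<in> ?D" for b using that D inj by (auto simp: k_def intro: inv_into_f_f)
    let ?g = "\<lambda>s. col A a (k s)"
    define xs where "xs = map (\<lambda>s. (s, ?g s)) (sorted_list_of_set (f ` ?D))"
    have fst_xs: "fst ` set xs = f ` ?D" using D(1) by (force simp: xs_def)
    have map_xs: "the (map_of xs s) = ?g s" if "s \<in> f ` ?D" for s
      using that D(1) by (simp add: xs_def map_of_map_restrict)
    have i: "?i < 4" using AL A(3) by (simp add: is_lgraph_def)
    have gK: "?g s \<in> K" if "s \<in> f ` ?D" for s
    proof -
      obtain b where b: "b \<in> ?D" "s = f b" using \<open>s \<in> f ` ?D\<close> by blast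
      then have "?g s \<in> C ?i (part A b)" using lgraph_col_in[OF AL A(3), of b] k[OF b(1)] by auto
      moreover have "part A b < 4" using b AL by (simp add: is_lgraph_def)
      ultimately show ?thesis using i b unfolding K_def by auto
    qed
    have "(?i, xs) \<in> Tasks" using i gK D(1) by (auto simp: Tasks_def xs_def)
    from from_nat_into_surj[OF \<open>countable Tasks\<close> this]
    obtain t where t: "from_nat_into Tasks t = (?i, xs)" ..
    have "finite (f ` (verts A - {a}))" using A(1) by simp
    then obtain m where m: "f ` (verts A - {a}) \<subseteq> {..<m}" by (metis finite_nat_iff_bounded)
    \<comment> \<open>A stage that serves task \<open>t\<close> and comes after every vertex in the
      image of \<open>f\<close>, so that the new vertex \<open>n\<close> differs from all of
      them.\<close>
    define n where "n = prod_encode (t, m)"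
    have "m \<le> n" unfolding n_def by (rule le_prod_encode_2)
    then have fn: "f b < n" if "b \<in> verts A" "b \<noteq> a" for b using m that by fastforce
    have task: "task n = (?i, xs)" by (simp add: task_def n_def t)
    have fD: "fst ` set xs \<subseteq> {..<n}" unfolding fst_xs using fn D(2) by auto
    let ?Y = "add_vertex (induced (S n) (fst ` set xs)) n ?i (the \<circ> map_of xs)"
    have f': "embedding f (induced A (verts A - {a})) (S n)"
      using into_S[OF f, of n] fn by auto
    \<comment> \<open>The task binds at this stage: sending \<open>n\<close> to \<open>a\<close> and
      undoing \<open>f\<close> embeds the demanded extension in the admissible graph
      \<open>A\<close>.\<close>
    have "embedding (k(n := a)) ?Y A"
      unfolding embedding_def add_vertex_simps induced_simps fst_xs
    proof (intro conjI ballI impI)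
      have ne: "f b \<noteq> n" if "b \<in> ?D" for b using fn[of b] that by auto
      show "inj_on (k(n := a)) (insert n (f ` ?D))"
        using k ne D(2) by (auto simp: inj_on_def)
      show "(k(n := a)) ` insert n (f ` ?D) \<subseteq> verts A"
        using k A(3) by auto
      fix s assume s: "s \<in> insert n (f ` ?D)"
      show "part A ((k(n := a)) s) = (if s = n then ?i else part (S n) s)"
      proof (cases "s = n")
        case False
        then obtain b where b: "b \<in> ?D" "s = f b" using s by blast
        then have "part (S n) s = part A b" using f' D(2) by (auto simp: embedding_def)
        then show ?thesis using False b k by simp
      qed simp
      fix s' assume s': "s' \<in> insert n (f ` ?D)"
        and ne': "(if s = n then ?i else part (S n) s) \<noteq> (if s' = n then ?i else part (S n) s')"
      show "col A ((k(n := a)) s) ((k(n := a)) s') =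
        (if s = n then (the \<circ> map_of xs) s' else if s' = n then (the \<circ> map_of xs) s
         else col (S n) s s')"
      proof (cases "s = n \<or> s' = n")
        case True
        then consider "s = n" "s' \<noteq> n" | "s \<noteq> n" "s' = n" using ne' by auto
        then show ?thesis
        proof cases
          case 1
          then show ?thesis using s' map_xs by auto
        next
          case 2
          then have "s \<in> f ` ?D" using s by simp
          then obtain b where b: "b \<in> ?D" "s = f b" by blast
          then show ?thesis
            using 2 map_xs k[OF b(1)] lgraph_col_commute[OF AL A(3), of b] by auto
        qed
      next
        case False
        then have "s \<in> f ` ?D" "s' \<in> f ` ?D" using s s' by simp_all
        then obtain b b' where b: "b \<in> ?D" "s = f b" "b' \<in> ?D" "s' = f b'" by blast
        then have bb': "b \<in> verts A - {a}" "b' \<in> verts A - {a}" using D(2) by blast+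
        then have "part A b \<noteq> part A b'"
          using ne' False f' b by (simp add: embedding_def)
        then have "col (S n) s s' = col A b b'" using f' b bb' by (simp add: embedding_def)
        then show ?thesis using False b k by simp
      qed
    qed
    from admissible_pullback[OF A(2) this] have "adm ?Y" .
    then have new: "part (S (Suc n)) n = ?i \<and>
        (\<forall>s\<in>fst ` set xs. col (S (Suc n)) n s = the (map_of xs s))"
      using S(2)[of n, unfolded Q_def, THEN conjunct2, THEN conjunct2, rule_format, of ?i xs] task i fD
      by blast
    then have n_part: "part (S (Suc n)) n = ?i" ..
    have n_col: "col (S (Suc n)) n s = ?g s" if "s \<in> f ` ?D" for s
    proof -
      have "col (S (Suc n)) n s = the (map_of xs s)" using new that unfolding fst_xs by blast
      then show ?thesis using map_xs[OF that] by simp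
    qed
    have G_n: "part G n = ?i" using n_part part_G[of n "Suc n"] by simp
    have G_col: "col G n (f b) = col A a b" "col G (f b) n = col A a b" if "b \<in> ?D" for b
    proof -
      have "b \<noteq> a" using that by blast
      then have "f b < Suc n" using fn[of b] that by simp
      then show *: "col G n (f b) = col A a b"
        using n_col[of "f b"] col_G[of n "Suc n" "f b"] k[OF that] that by simp
      have "part G (f b) = part A b" using f that \<open>b \<noteq> a\<close> by (simp add: embedding_def)
      then have "part G (f b) \<noteq> part G n" using G_n that by simp
      then show "col G (f b) n = col A a b"
        using lgraph_col_commute[of 4 C G "f b" n] adm_G * by (simp add: admissible_def G_def)
    qed
    have "embedding (f(a := n)) A G"
      unfolding embedding_def
    proof (intro conjI ballI impI)
      show "inj_on (f(a := n)) (verts A)"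
        using inj fn unfolding inj_on_def by (metis DiffI fun_upd_apply less_irrefl singletonD)
      show "(f(a := n)) ` verts A \<subseteq> verts G" by (simp add: G_def)
      fix x assume x: "x \<in> verts A"
      then show "part G ((f(a := n)) x) = part A x"
        using f G_n by (auto simp: embedding_def)
      fix y assume y: "y \<in> verts A" "part A x \<noteq> part A y"
      then show "col G ((f(a := n)) x) ((f(a := n)) y) = col A x y"
        using f G_col[of x] G_col[of y] x lgraph_col_commute[OF AL x y] by (auto simp: embedding_def)
    qed
    then show "\<exists>y. embedding (f(a := y)) A G" ..
  qed
  ultimately show ?thesis by blast
qed

text \<open>A member of \<F> embeds in itself and so lies outside \<open>Forb(\<F>)\<close>; if the
  age is that class, \<open>G\<close> omits the member.\<close>

lemma age_imp_admissible:
  fixes G :: "('v, 'c) lgraph"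
  assumes "is_lgraph 4 C G" "age 4 C G = forb 4 C \<F>"
  shows "adm G"
proof -
  have "\<not> embeds B G" if B: "B \<in> \<F>" for B
  proof
    assume "embeds B G"
    then have "B \<in> age 4 C G" using monics[OF B] by (simp add: age_def monic_def)
    moreover have "embeds B B" using embedding_id[of "verts B" B] by (auto simp: embeds_def)
    ultimately show False using assms(2) B by (auto simp: forb_def)
  qed
  then show ?thesis using assms(1) by (simp add: admissible_def omits_def)
qed

end

theorem theorem5p2:
  fixes C :: "nat \<Rightarrow> nat \<Rightarrow> 'c set" and \<F> :: "(nat, 'c) lgraph set"
  assumes "language 4 C"
    and "\<forall>A\<in>\<F>. monic 4 C A"
    and "pairwise_non_embeddable \<F>"
  shows "((\<exists>G :: (nat, 'c) lgraph. countable_homogeneous_generic_with_age 4 C (forb 4 C \<F>) G) \<longleftrightarrow>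
            no_small_members \<F> \<and> omission_condition C \<F> \<and> cover_condition C \<F>) \<and>
         (\<forall>(G :: ('v, 'c) lgraph) (H :: ('w, 'c) lgraph).
            countable_homogeneous_generic_with_age 4 C (forb 4 C \<F>) G \<and>
            countable_homogeneous_generic_with_age 4 C (forb 4 C \<F>) H \<longrightarrow> isomorphic G H)"
proof (intro conjI iffI allI impI)
  interpret quadripartite C \<F> using assms by unfold_locales auto
  {
    assume "\<exists>G :: (nat, 'c) lgraph. countable_homogeneous_generic_with_age 4 C (forb 4 C \<F>) G"
    then obtain G :: "(nat, 'c) lgraph" where G: "is_lgraph 4 C G" "homogeneous G" "generic 4 C G"
        "age 4 C G = forb 4 C \<F>"
      by (auto simp: countable_homogeneous_generic_with_age_def)
    have adm: "adm G" using age_imp_admissible G by blast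
    have real: "realizes 4 C \<F> G" using homogeneous_imp_realizes G by blast
    show small: "no_small_members \<F>" using generic_imp_no_small_members G adm by blast
    show "omission_condition C \<F>" using realizes_imp_omission_condition[OF adm real small] .
    show "cover_condition C \<F>" using realizes_imp_cover_condition[OF adm real small assms(3)] .
  next
    assume *: "no_small_members \<F> \<and> omission_condition C \<F> \<and> cover_condition C \<F>"
    then obtain G :: "(nat, 'c) lgraph" where G: "adm G" "realizes 4 C \<F> G"
      using exists_realizing by blast
    have "countable (verts G)" by simp
    then have "countable_homogeneous_generic_with_age 4 C (forb 4 C \<F>) G"
      using G realizes_imp_homogeneous realizes_imp_age realizes_imp_generic *
      unfolding countable_homogeneous_generic_with_age_def admissible_def by blast
    then show "\<exists>G :: (nat, 'c) lgraph. countable_homogeneous_generic_with_age 4 C (forb 4 C \<F>) G" ..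
  next
    fix G :: "('v, 'c) lgraph" and H :: "('w, 'c) lgraph"
    assume "countable_homogeneous_generic_with_age 4 C (forb 4 C \<F>) G \<and>
            countable_homogeneous_generic_with_age 4 C (forb 4 C \<F>) H"
    then have GH: "is_lgraph 4 C G" "homogeneous G" "countable (verts G)" "age 4 C G = forb 4 C \<F>"
        "is_lgraph 4 C H" "homogeneous H" "countable (verts H)" "age 4 C H = forb 4 C \<F>"
      by (auto simp: countable_homogeneous_generic_with_age_def)
    \<comment> \<open>Back-and-forth starts from the empty map: homogeneity and the common age make
      both graphs realise the same one-point extensions.\<close>
    have "partial_iso G H {}" by (simp add: partial_iso_def)
    then obtain f where "isomorphism f G H"
      using back_and_forth[of G 4 C \<F> H "{}"] GH
        age_imp_admissible[of G] age_imp_admissible[of H]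
        homogeneous_imp_realizes[of G 4 C \<F>] homogeneous_imp_realizes[of H 4 C \<F>] by auto
    then show "isomorphic G H" by (auto simp: isomorphic_def)
  }
qed

end
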